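(* Each of the following statistics: nrcpeak, nrcval, $\mathrm{nrcpeak}+\mathrm{nrcval}+\mathrm{nrcdrise}+\mathrm{nrcdfall}$, lcrosscpeak, lnestcpeak, ucrosscval, unestcval, lcross, lnest, ucross, unest, $\mathrm{ucross}+\mathrm{lcross}$, $\mathrm{unest}+\mathrm{lnest}$, exhibits the cyclic sieving phenomenon on D-e-semiderangements, on D-o-semiderangements, and on D-derangements of $[2n]$, with respect to involutions having $1$ fixed point when $n=0$ and, for $n\ge1$, $3^{n-1}$, $3^{n-1}$, $2^{n-1}$ fixed points respectively.
   Context: A D-permutation of $[2n]$ is a permutation $\sigma$ of $[2n]$ with $\sigma(2k-1)\ge2k-1$ and $\sigma(2k)\le2k$ for all $k$. A D-e-semiderangement (resp. D-o-semiderangement, D-derangement) is a D-permutation with no even fixed points (resp. no odd fixed points, no fixed points). For $i\in[2n]$: cycle peak if $\sigma^{-1}(i)<i>\sigma(i)$, cycle valley if $\sigma^{-1}(i)>i<\sigma(i)$, cycle double rise if $\sigma^{-1}(i)<i<\sigma(i)$, cycle double fall if $\sigma^{-1}(i)>i>\sigma(i)$. $i$ is a record if $\sigma(j)<\sigma(i)$ for all $j<i$, an antirecord if $\sigma(j)>\sigma(i)$ for all $j>i$; nrcpeak, nrcval, nrcdrise, nrcdfall = numbers of cycle peaks, valleys, double rises, double falls that are neither records nor antirecords. $\mathrm{ucross}(i,\sigma)=\#\{j:j<i<\sigma(j)<\sigma(i)\}$, $\mathrm{unest}(i,\sigma)=\#\{j:j<i<\sigma(i)<\sigma(j)\}$,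 $\mathrm{lcross}(i,\sigma)=\#\{j:j>i>\sigma(j)>\sigma(i)\}$, $\mathrm{lnest}(i,\sigma)=\#\{j:j>i>\sigma(i)>\sigma(j)\}$; ucross, unest, lcross, lnest are sums over all $i$; ucrosscval, unestcval are sums over cycle valleys; lcrosscpeak, lnestcpeak are sums over cycle peaks. Cyclic sieving for involutions: for an involution $\phi$ on a finite set $X$ and polynomial $f$, $(X,\{\mathrm{id},\phi\},f)$ exhibits the CSP iff $f(1)=|X|$ and $f(-1)$ equals the number of fixed points of $\phi$; a statistic exhibits the CSP on a family $(X_n)$ with respect to involutions having $a_n$ fixed points if for every $n\ge0$ and every involution $\phi$ of $X_n$ with exactly $a_n$ fixed points, $(X_n,\{\mathrm{id},\phi\},\sum_{x\in X_n}q^{\mathrm{stat}(x)})$ exhibits the CSP. *)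

theory Defs
  imports "HOL-Combinatorics.Permutations" "HOL-Computational_Algebra.Polynomial"
begin

(* Permutations of [2n] are functions s :: nat => nat with s permutes {1..2*n}. The statistics
   take the size N of the ground set [N] = {1..N} as an explicit argument. *)

definition D_permutations :: "nat \<Rightarrow> (nat \<Rightarrow> nat) set" where
  "D_permutations n = {\<sigma>. \<sigma> permutes {1..2*n} \<and>
     (\<forall>k\<in>{1..n}. \<sigma> (2*k - 1) \<ge> 2*k - 1 \<and> \<sigma> (2*k) \<le> 2*k)}"

definition D_e_semiderangements :: "nat \<Rightarrow> (nat \<Rightarrow> nat) set" where
  "D_e_semiderangements n =
     {\<sigma> \<in> D_permutations n. \<forall>i\<in>{1..2*n}. even i \<longrightarrow> \<sigma> i \<noteq> i}"

definition D_o_semiderangements :: "nat \<Rightarrow> (nat \<Rightarrow> nat) set" where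
  "D_o_semiderangements n =
     {\<sigma> \<in> D_permutations n. \<forall>i\<in>{1..2*n}. odd i \<longrightarrow> \<sigma> i \<noteq> i}"

definition D_derangements :: "nat \<Rightarrow> (nat \<Rightarrow> nat) set" where
  "D_derangements n = {\<sigma> \<in> D_permutations n. \<forall>i\<in>{1..2*n}. \<sigma> i \<noteq> i}"

definition cycle_peaks :: "nat \<Rightarrow> (nat \<Rightarrow> nat) \<Rightarrow> nat set" where
  "cycle_peaks N \<sigma> = {i\<in>{1..N}. inv \<sigma> i < i \<and> i > \<sigma> i}"

definition cycle_valleys :: "nat \<Rightarrow> (nat \<Rightarrow> nat) \<Rightarrow> nat set" where
  "cycle_valleys N \<sigma> = {i\<in>{1..N}. inv \<sigma> i > i \<and> i < \<sigma> i}"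

definition cycle_double_rises :: "nat \<Rightarrow> (nat \<Rightarrow> nat) \<Rightarrow> nat set" where
  "cycle_double_rises N \<sigma> = {i\<in>{1..N}. inv \<sigma> i < i \<and> i < \<sigma> i}"

definition cycle_double_falls :: "nat \<Rightarrow> (nat \<Rightarrow> nat) \<Rightarrow> nat set" where
  "cycle_double_falls N \<sigma> = {i\<in>{1..N}. inv \<sigma> i > i \<and> i > \<sigma> i}"

definition is_record :: "nat \<Rightarrow> (nat \<Rightarrow> nat) \<Rightarrow> nat \<Rightarrow> bool" where
  "is_record N \<sigma> i \<longleftrightarrow> (\<forall>j\<in>{1..N}. j < i \<longrightarrow> \<sigma> j < \<sigma> i)"

definition is_antirecord :: "nat \<Rightarrow> (nat \<Rightarrow> nat) \<Rightarrow> nat \<Rightarrow> bool" where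
  "is_antirecord N \<sigma> i \<longleftrightarrow> (\<forall>j\<in>{1..N}. j > i \<longrightarrow> \<sigma> j > \<sigma> i)"

definition nrcpeak :: "nat \<Rightarrow> (nat \<Rightarrow> nat) \<Rightarrow> nat" where
  "nrcpeak N \<sigma> = card {i \<in> cycle_peaks N \<sigma>. \<not> is_record N \<sigma> i \<and> \<not> is_antirecord N \<sigma> i}"

definition nrcval :: "nat \<Rightarrow> (nat \<Rightarrow> nat) \<Rightarrow> nat" where
  "nrcval N \<sigma> = card {i \<in> cycle_valleys N \<sigma>. \<not> is_record N \<sigma> i \<and> \<not> is_antirecord N \<sigma> i}"

definition nrcdrise :: "nat \<Rightarrow> (nat \<Rightarrow> nat) \<Rightarrow> nat" where
  "nrcdrise N \<sigma> =
     card {i \<in> cycle_double_rises N \<sigma>. \<not> is_record N \<sigma> i \<and> \<not> is_antirecord N \<sigma> i}"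

definition nrcdfall :: "nat \<Rightarrow> (nat \<Rightarrow> nat) \<Rightarrow> nat" where
  "nrcdfall N \<sigma> =
     card {i \<in> cycle_double_falls N \<sigma>. \<not> is_record N \<sigma> i \<and> \<not> is_antirecord N \<sigma> i}"

definition ucross_at :: "nat \<Rightarrow> (nat \<Rightarrow> nat) \<Rightarrow> nat \<Rightarrow> nat" where
  "ucross_at N \<sigma> i = card {j\<in>{1..N}. j < i \<and> i < \<sigma> j \<and> \<sigma> j < \<sigma> i}"

definition unest_at :: "nat \<Rightarrow> (nat \<Rightarrow> nat) \<Rightarrow> nat \<Rightarrow> nat" where
  "unest_at N \<sigma> i = card {j\<in>{1..N}. j < i \<and> i < \<sigma> i \<and> \<sigma> i < \<sigma> j}"

definition lcross_at :: "nat \<Rightarrow> (nat \<Rightarrow> nat) \<Rightarrow> nat \<Rightarrow> nat" where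
  "lcross_at N \<sigma> i = card {j\<in>{1..N}. j > i \<and> i > \<sigma> j \<and> \<sigma> j > \<sigma> i}"

definition lnest_at :: "nat \<Rightarrow> (nat \<Rightarrow> nat) \<Rightarrow> nat \<Rightarrow> nat" where
  "lnest_at N \<sigma> i = card {j\<in>{1..N}. j > i \<and> i > \<sigma> i \<and> \<sigma> i > \<sigma> j}"

definition ucross :: "nat \<Rightarrow> (nat \<Rightarrow> nat) \<Rightarrow> nat" where
  "ucross N \<sigma> = (\<Sum>i\<in>{1..N}. ucross_at N \<sigma> i)"

definition unest :: "nat \<Rightarrow> (nat \<Rightarrow> nat) \<Rightarrow> nat" where
  "unest N \<sigma> = (\<Sum>i\<in>{1..N}. unest_at N \<sigma> i)"

definition lcross :: "nat \<Rightarrow> (nat \<Rightarrow> nat) \<Rightarrow> nat" where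
  "lcross N \<sigma> = (\<Sum>i\<in>{1..N}. lcross_at N \<sigma> i)"

definition lnest :: "nat \<Rightarrow> (nat \<Rightarrow> nat) \<Rightarrow> nat" where
  "lnest N \<sigma> = (\<Sum>i\<in>{1..N}. lnest_at N \<sigma> i)"

definition ucrosscval :: "nat \<Rightarrow> (nat \<Rightarrow> nat) \<Rightarrow> nat" where
  "ucrosscval N \<sigma> = (\<Sum>i\<in>cycle_valleys N \<sigma>. ucross_at N \<sigma> i)"

definition unestcval :: "nat \<Rightarrow> (nat \<Rightarrow> nat) \<Rightarrow> nat" where
  "unestcval N \<sigma> = (\<Sum>i\<in>cycle_valleys N \<sigma>. unest_at N \<sigma> i)"

definition lcrosscpeak :: "nat \<Rightarrow> (nat \<Rightarrow> nat) \<Rightarrow> nat" where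
  "lcrosscpeak N \<sigma> = (\<Sum>i\<in>cycle_peaks N \<sigma>. lcross_at N \<sigma> i)"

definition lnestcpeak :: "nat \<Rightarrow> (nat \<Rightarrow> nat) \<Rightarrow> nat" where
  "lnestcpeak N \<sigma> = (\<Sum>i\<in>cycle_peaks N \<sigma>. lnest_at N \<sigma> i)"

definition involution_on :: "'a set \<Rightarrow> ('a \<Rightarrow> 'a) \<Rightarrow> bool" where
  "involution_on X \<phi> \<longleftrightarrow> (\<forall>x\<in>X. \<phi> x \<in> X \<and> \<phi> (\<phi> x) = x)"

(* The triple (X, {id, phi}, f), for phi an involution of the finite set X. *)
definition exhibits_CSP :: "'a set \<Rightarrow> ('a \<Rightarrow> 'a) \<Rightarrow> int poly \<Rightarrow> bool" where
  "exhibits_CSP X \<phi> f \<longleftrightarrow>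
     poly f 1 = int (card X) \<and> poly f (-1) = int (card {x\<in>X. \<phi> x = x})"

definition stat_poly :: "'a set \<Rightarrow> ('a \<Rightarrow> nat) \<Rightarrow> int poly" where
  "stat_poly X stat = (\<Sum>x\<in>X. monom 1 (stat x))"

definition stat_exhibits_CSP ::
  "(nat \<Rightarrow> 'a \<Rightarrow> nat) \<Rightarrow> (nat \<Rightarrow> 'a set) \<Rightarrow> (nat \<Rightarrow> nat) \<Rightarrow> bool" where
  "stat_exhibits_CSP stat X a \<longleftrightarrow>
     (\<forall>n \<phi>. involution_on (X n) \<phi> \<and> card {x \<in> X n. \<phi> x = x} = a n \<longrightarrow>
        exhibits_CSP (X n) \<phi> (stat_poly (X n) (stat n)))"

end

theory Submission
  imports Defs
begin

text \<open>
  Draw a permutation as upward arcs \<open>i < \<sigma> i\<close> and downward arcs \<open>\<sigma> i < i\<close>; over each gap between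
  consecutive integers equally many arcs of both kinds are open, and this number is the height
  there. If the height never exceeds one, no two arcs of the same kind cross or nest, so every
  statistic vanishes. Otherwise let \<open>p\<close> be the last point where the height drops from two to one;
  it is a cycle peak, and exactly one other downward arc, from some \<open>r > p\<close>, is open there.
  Interchanging the images of \<open>p\<close> and \<open>r\<close> turns the crossing of these two arcs into a nesting and
  vice versa, and affects no other point, no upward arc and no cycle type. Hence it reverses the sign
  of every statistic that involves downward arcs at cycle peaks. Reversing \<open>[2n]\<close> exchanges
  upward and downward arcs, which settles the remaining statistics. So at \<open>q = -1\<close> each generating
  polynomial counts the permutations of height at most one, and these satisfy a recursion with
  factor 3 for semiderangements and 2 for derangements.
\<close>

subsection \<open>The sign-reversing swap\<close>

text \<open>
  Height at most one: just below every \<open>i\<close> with \<open>\<sigma> i < i\<close>, the arc from \<open>i\<close> is the only downward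
  arc that is open. By \<open>low_imp_rises_disjoint\<close> and reversal the same then holds for upward arcs.
\<close>

definition low :: "(nat \<Rightarrow> nat) \<Rightarrow> bool" where
  "low \<sigma> \<longleftrightarrow> (\<forall>i j. i < j \<longrightarrow> \<sigma> i < i \<longrightarrow> i \<le> \<sigma> j)"

text \<open>These are the falls just below which a second downward arc is open, so exactly the
  places where \<open>low\<close> fails.\<close>

definition crit :: "(nat \<Rightarrow> nat) \<Rightarrow> nat set" where
  "crit \<sigma> = {i. \<exists>j>i. \<sigma> i < i \<and> \<sigma> j < i}"

definition pivot :: "(nat \<Rightarrow> nat) \<Rightarrow> nat" where
  "pivot \<sigma> = Max (crit \<sigma>)"

text \<open>The choice made by \<open>SOME\<close> is the only possible one for a permutation that
  is not low, by \<open>partner_unique\<close>.\<close>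

definition partner :: "(nat \<Rightarrow> nat) \<Rightarrow> nat" where
  "partner \<sigma> = (SOME j. pivot \<sigma> < j \<and> \<sigma> j < pivot \<sigma>)"

definition swap_pivot :: "(nat \<Rightarrow> nat) \<Rightarrow> nat \<Rightarrow> nat" where
  "swap_pivot \<sigma> = \<sigma> \<circ> transpose (pivot \<sigma>) (partner \<sigma>)"

lemma low_iff_crit_empty: "low \<sigma> \<longleftrightarrow> crit \<sigma> = {}"
  unfolding low_def crit_def by (simp add: set_eq_iff) (meson not_less)

section \<open>Pivot, partner and the swap in a permutation that is not low\<close>

locale high_permutation =
  fixes N :: nat and \<sigma> :: "nat \<Rightarrow> nat"
  assumes perm: "\<sigma> permutes {1..N}" and high: "\<not> low \<sigma>"
begin

abbreviation "p \<equiv> pivot \<sigma>"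
abbreviation "r \<equiv> partner \<sigma>"
abbreviation "\<tau> \<equiv> swap_pivot \<sigma>"

lemma moved_in: "\<sigma> i \<noteq> i \<Longrightarrow> i \<in> {1..N}"
  using perm by (meson permutes_not_in)

lemma finite_crit: "finite (crit \<sigma>)"
proof (rule finite_subset)
  show "crit \<sigma> \<subseteq> {1..N}" using moved_in less_imp_neq unfolding crit_def by blast
qed simp

lemma pivot_crit: "p \<in> crit \<sigma>"
  unfolding pivot_def using finite_crit high low_iff_crit_empty by (intro Max_in) auto

lemma crit_le: "i \<in> crit \<sigma> \<Longrightarrow> i \<le> p"
  unfolding pivot_def using finite_crit by simp

lemma not_crit: "p < i \<Longrightarrow> i < j \<Longrightarrow> \<sigma> i < i \<Longrightarrow> i \<le> \<sigma> j"
  using crit_le[of i] unfolding crit_def by (rule_tac ccontr) (auto simp: not_le)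

lemma partner: "p < r" "\<sigma> r < p"
proof -
  have "\<exists>j. p < j \<and> \<sigma> j < p" using pivot_crit unfolding crit_def by blast
  then have "p < r \<and> \<sigma> r < p" unfolding partner_def by (rule someI_ex)
  then show "p < r" "\<sigma> r < p" by auto
qed

lemma pivot_fall: "\<sigma> p < p"
  using pivot_crit unfolding crit_def by blast

text \<open>If \<open>j\<close> and \<open>r\<close> were different, the smaller of them would be a
  critical point beyond the pivot.\<close>

lemma partner_unique: "p < j \<Longrightarrow> \<sigma> j < p \<Longrightarrow> j = r"
  using not_crit[of j r] not_crit[of r j] partner by (cases j r rule: linorder_cases) auto

lemma images_distinct: "\<sigma> p \<noteq> \<sigma> r"
  using partner(1) permutes_inj[OF perm] by (metis injD nat_neq_iff)

lemma in_range: "p \<in> {1..N}" "r \<in> {1..N}"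
proof -
  show "p \<in> {1..N}" using pivot_fall by (intro moved_in) simp
  show "r \<in> {1..N}" using partner by (intro moved_in) simp
qed

text \<open>Otherwise the preimage of \<open>p\<close> and the partner are two different points
  above \<open>p\<close> with images at most \<open>p\<close>, and the smaller one is a critical
  point beyond the pivot.\<close>

lemma inv_pivot: "inv \<sigma> p < p"
proof (rule ccontr)
  assume a: "\<not> inv \<sigma> p < p"
  define q where "q = inv \<sigma> p"
  have q: "\<sigma> q = p" unfolding q_def using permutes_inverses(1)[OF perm] .
  have "q \<noteq> p" "q \<noteq> r" using q pivot_fall partner by auto
  then have "p < q" "q \<noteq> r" using a q_def by auto
  then show False
    using not_crit[of q r] not_crit[of r q] q partner by (cases q r rule: linorder_cases) auto
qed

lemma pivot_peak: "p \<in> cycle_peaks N \<sigma>"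
  using inv_pivot pivot_fall in_range unfolding cycle_peaks_def by simp

lemma swap_simps: "\<tau> p = \<sigma> r" "\<tau> r = \<sigma> p" "x \<noteq> p \<Longrightarrow> x \<noteq> r \<Longrightarrow> \<tau> x = \<sigma> x"
  unfolding swap_pivot_def by (auto simp: transpose_def)

lemma swap_permutes: "\<tau> permutes {1..N}"
  unfolding swap_pivot_def using in_range perm
  by (intro permutes_compose permutes_swap_id) auto

text \<open>Both exchanged images lie below \<open>p\<close>, so a threshold at or above
  \<open>p\<close> cannot tell them apart. Hence the swap keeps the critical points from
  \<open>p\<close> upwards, the pivot and the partner, which makes it an involution.\<close>

lemma swap_less: "p \<le> i \<Longrightarrow> \<tau> x < i \<longleftrightarrow> \<sigma> x < i"
  using swap_simps partner pivot_fall by (cases "x = p \<or> x = r") auto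

text \<open>Both exchanged images lie below \<open>p < r\<close>, so \<open>p\<close> and
  \<open>r\<close> remain falls. This keeps the inequalities of a D-permutation and the fixed
  points.\<close>

lemma swap_type: "\<tau> x < x \<longleftrightarrow> \<sigma> x < x" "x < \<tau> x \<longleftrightarrow> x < \<sigma> x"
proof -
  consider "x = p" | "x = r" | "x \<noteq> p" "x \<noteq> r" by blast
  then have "(\<tau> x < x \<longleftrightarrow> \<sigma> x < x) \<and> (x < \<tau> x \<longleftrightarrow> x < \<sigma> x)"
    by cases (use partner pivot_fall in \<open>simp_all add: swap_simps\<close>)
  then show "\<tau> x < x \<longleftrightarrow> \<sigma> x < x" "x < \<tau> x \<longleftrightarrow> x < \<sigma> x" by auto
qed

lemma swap_fix: "\<tau> x = x \<longleftrightarrow> \<sigma> x = x"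
  using swap_type[of x] by (metis nat_neq_iff)

lemma inv_swap: "inv \<tau> x = transpose p r (inv \<sigma> x)"
  unfolding swap_pivot_def
  by (subst o_inv_distrib) (auto simp: permutes_bij[OF perm] inv_transpose_eq)

text \<open>Only \<open>\<sigma> p\<close> and \<open>\<sigma> r\<close> change their preimage. Both
  lie below \<open>p < r\<close>, so the old and the new preimage are on the same side.\<close>

lemma swap_inv_type: "inv \<tau> x < x \<longleftrightarrow> inv \<sigma> x < x" "x < inv \<tau> x \<longleftrightarrow> x < inv \<sigma> x"
proof -
  have "x < p" if "inv \<sigma> x = p \<or> inv \<sigma> x = r"
    using that permutes_inverses(1)[OF perm, of x] partner pivot_fall by auto
  then show "inv \<tau> x < x \<longleftrightarrow> inv \<sigma> x < x" "x < inv \<tau> x \<longleftrightarrow> x < inv \<sigma> x"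
    unfolding inv_swap using partner(1) by (auto simp: transpose_def)
qed

lemma swap_cycle_types:
  "cycle_peaks N \<tau> = cycle_peaks N \<sigma>" "cycle_valleys N \<tau> = cycle_valleys N \<sigma>"
  "cycle_double_rises N \<tau> = cycle_double_rises N \<sigma>"
  "cycle_double_falls N \<tau> = cycle_double_falls N \<sigma>"
  unfolding cycle_peaks_def cycle_valleys_def cycle_double_rises_def cycle_double_falls_def
  by (simp_all add: swap_type swap_inv_type)

lemma swap_crit_iff: "p \<le> i \<Longrightarrow> i \<in> crit \<tau> \<longleftrightarrow> i \<in> crit \<sigma>"
  unfolding crit_def by (simp add: swap_less)

lemma swap_high: "high_permutation N \<tau>"
  using swap_permutes swap_crit_iff[of p] pivot_crit low_iff_crit_empty
  by unfold_locales auto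

lemma swap_pivot_eq: "pivot \<tau> = p"
proof -
  interpret s: high_permutation N \<tau> by (rule swap_high)
  have "p \<le> s.p" using s.crit_le swap_crit_iff[of p] pivot_crit by simp
  moreover from this have "s.p \<le> p" using crit_le swap_crit_iff[of s.p] s.pivot_crit by simp
  ultimately show ?thesis by simp
qed

lemma swap_partner_eq: "partner \<tau> = r"
  unfolding partner_def swap_pivot_eq by (simp add: swap_less)

lemma swap_swap: "swap_pivot \<tau> = \<sigma>"
proof -
  have "swap_pivot \<tau> = \<tau> \<circ> transpose p r"
    unfolding swap_pivot_def[of \<tau>] swap_pivot_eq swap_partner_eq ..
  also have "\<dots> = \<sigma>" unfolding swap_pivot_def by (simp add: comp_assoc)
  finally show ?thesis .
qed

text \<open>For \<open>x < p\<close> both \<open>p\<close> and \<open>r\<close> lie above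
  \<open>x\<close>, and the transposition matches the arcs counted at \<open>x\<close> before and
  after the swap. For \<open>x > p\<close> both counts are zero, since an arc counted there would
  make \<open>x\<close> critical.\<close>

lemma swap_lower_at:
  assumes "x \<noteq> p"
  shows "lcross_at N \<tau> x = lcross_at N \<sigma> x" "lnest_at N \<tau> x = lnest_at N \<sigma> x"
proof -
  interpret s: high_permutation N \<tau> by (rule swap_high)
  consider "x < p" | "p < x" using assms by linarith
  then have "lcross_at N \<tau> x = lcross_at N \<sigma> x \<and> lnest_at N \<tau> x = lnest_at N \<sigma> x"
  proof cases
    case 1
    define t where "t = transpose p r"
    have t: "bij_betw t {j\<in>{1..N}. P j} {j\<in>{1..N}. P (t j)}" for P
    proof (rule bij_betw_byWitness[where f' = t])
      have "t j \<in> {1..N}" if "j \<in> {1..N}" for j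
        using that in_range unfolding t_def by (auto simp: transpose_def)
      moreover have "t (t j) = j" for j by (simp add: t_def)
      ultimately show "t ` {j\<in>{1..N}. P j} \<subseteq> {j\<in>{1..N}. P (t j)}"
        "t ` {j\<in>{1..N}. P (t j)} \<subseteq> {j\<in>{1..N}. P j}"
        by (simp_all add: image_subset_iff)
    qed (auto simp: t_def)
    have tx: "x < t j \<longleftrightarrow> x < j" for j
      using 1 partner(1) unfolding t_def by (auto simp: transpose_def)
    have \<tau>: "\<tau> j = \<sigma> (t j)" for j by (simp add: swap_pivot_def t_def)
    have x: "\<tau> x = \<sigma> x" using 1 partner(1) by (intro swap_simps) auto
    have "lcross_at N \<sigma> x = lcross_at N \<tau> x"
      unfolding lcross_at_def x
      using bij_betw_same_card[OF t[of "\<lambda>j. x < j \<and> \<sigma> j < x \<and> \<sigma> x < \<sigma> j"]]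
      by (simp add: tx \<tau>)
    moreover have "lnest_at N \<sigma> x = lnest_at N \<tau> x"
      unfolding lnest_at_def x
      using bij_betw_same_card[OF t[of "\<lambda>j. x < j \<and> \<sigma> x < x \<and> \<sigma> j < \<sigma> x"]]
      by (simp add: tx \<tau>)
    ultimately show ?thesis by simp
  next
    case 2
    have "{j\<in>{1..N}. j > x \<and> x > \<sigma> j \<and> \<sigma> j > \<sigma> x} = {}"
      "{j\<in>{1..N}. j > x \<and> x > \<sigma> x \<and> \<sigma> x > \<sigma> j} = {}"
      using not_crit[OF 2] by (fastforce simp del: One_nat_def)+
    moreover have "{j\<in>{1..N}. j > x \<and> x > \<tau> j \<and> \<tau> j > \<tau> x} = {}"
      "{j\<in>{1..N}. j > x \<and> x > \<tau> x \<and> \<tau> x > \<tau> j} = {}"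
      using s.not_crit[of x, unfolded swap_pivot_eq, OF 2]
      by (fastforce simp del: One_nat_def)+
    ultimately show ?thesis unfolding lcross_at_def lnest_at_def by (simp only: card.empty)
  qed
  then show "lcross_at N \<tau> x = lcross_at N \<sigma> x" "lnest_at N \<tau> x = lnest_at N \<sigma> x"
    by auto
qed

text \<open>The arc from \<open>r\<close> is the only other downward arc open at \<open>p\<close>;
  it is counted as a crossing or as a nesting according to the order of the two images.\<close>

lemma lower_at_pivot:
  "lcross_at N \<sigma> p = (if \<sigma> p < \<sigma> r then 1 else 0)"
  "lnest_at N \<sigma> p = (if \<sigma> r < \<sigma> p then 1 else 0)"
proof -
  have r: "j \<in> {1..N} \<and> p < j \<and> \<sigma> j < p \<longleftrightarrow> j = r" for j
    using partner_unique partner in_range(2) by blast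
  have "{j\<in>{1..N}. j > p \<and> p > \<sigma> j \<and> \<sigma> j > \<sigma> p} = {j. j = r \<and> \<sigma> j > \<sigma> p}"
    using r by blast
  also have "\<dots> = (if \<sigma> p < \<sigma> r then {r} else {})" by auto
  finally show "lcross_at N \<sigma> p = (if \<sigma> p < \<sigma> r then 1 else 0)"
    unfolding lcross_at_def by simp
  have "{j\<in>{1..N}. j > p \<and> p > \<sigma> p \<and> \<sigma> p > \<sigma> j} = {j. j = r \<and> \<sigma> p > \<sigma> j}"
    using r pivot_fall by (force simp del: One_nat_def)
  also have "\<dots> = (if \<sigma> r < \<sigma> p then {r} else {})" by auto
  finally show "lnest_at N \<sigma> p = (if \<sigma> r < \<sigma> p then 1 else 0)"
    unfolding lnest_at_def by simp
qed

lemma swap_lower_at_pivot: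
  "lcross_at N \<tau> p = 1 - lcross_at N \<sigma> p" "lnest_at N \<tau> p = 1 - lnest_at N \<sigma> p"
  "lcross_at N \<sigma> p \<le> 1" "lnest_at N \<sigma> p \<le> 1"
proof -
  interpret s: high_permutation N \<tau> by (rule swap_high)
  show "lcross_at N \<tau> p = 1 - lcross_at N \<sigma> p" "lnest_at N \<tau> p = 1 - lnest_at N \<sigma> p"
    "lcross_at N \<sigma> p \<le> 1" "lnest_at N \<sigma> p \<le> 1"
    using s.lower_at_pivot lower_at_pivot images_distinct
    unfolding swap_pivot_eq swap_partner_eq swap_simps by auto
qed

text \<open>Neither \<open>p\<close> nor \<open>r\<close> is the source of an upward arc, before or
  after the swap, so all upward arcs keep their ends.\<close>

lemma swap_upper_at:
  "ucross_at N \<tau> x = ucross_at N \<sigma> x" "unest_at N \<tau> x = unest_at N \<sigma> x"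
proof -
  have up: "\<tau> j = \<sigma> j" if "j < \<sigma> j \<or> j < \<tau> j" for j
  proof (rule swap_simps)
    have "j < \<sigma> j" using that swap_type by blast
    then show "j \<noteq> p" "j \<noteq> r" using partner pivot_fall by auto
  qed
  have "j < x \<and> x < \<tau> j \<and> \<tau> j < \<tau> x \<longleftrightarrow> j < x \<and> x < \<sigma> j \<and> \<sigma> j < \<sigma> x" for j
    using up[of j] up[of x]
    by (cases "j < \<sigma> j \<or> j < \<tau> j"; cases "x < \<sigma> x \<or> x < \<tau> x") auto
  then show "ucross_at N \<tau> x = ucross_at N \<sigma> x" unfolding ucross_at_def by simp
  have "j < x \<and> x < \<tau> x \<and> \<tau> x < \<tau> j \<longleftrightarrow> j < x \<and> x < \<sigma> x \<and> \<sigma> x < \<sigma> j" for j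
    using up[of j] up[of x]
    by (cases "j < \<sigma> j \<or> j < \<tau> j"; cases "x < \<sigma> x \<or> x < \<tau> x") auto
  then show "unest_at N \<tau> x = unest_at N \<sigma> x" unfolding unest_at_def by simp
qed

lemma swap_sum_parity:
  fixes f g :: "nat \<Rightarrow> nat"
  assumes "\<And>x. x \<noteq> p \<Longrightarrow> g x = f x" "f p \<le> 1" "g p = 1 - f p" "p \<in> A" "finite A"
  shows "even (sum g A) \<longleftrightarrow> odd (sum f A)"
proof -
  define c where "c = sum f (A - {p})"
  have "sum g (A - {p}) = c" unfolding c_def using assms(1) by (intro sum.cong) auto
  then have "sum f A = f p + c" "sum g A = g p + c"
    using sum.remove[OF assms(5,4), of f] sum.remove[OF assms(5,4), of g] unfolding c_def by metis+
  moreover have "f p = 0 \<or> f p = 1" using assms(2) by auto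
  ultimately show ?thesis using assms(3) by auto
qed

end

section \<open>Records and antirecords among rises and falls\<close>

text \<open>Were \<open>x\<close> a record, the \<open>x - 1\<close> earlier points would be mapped
  injectively into the \<open>\<sigma> x - 1\<close> smaller positive values, which are too few. A
  later image below \<open>\<sigma> x\<close> is exactly a nesting at \<open>x\<close>.\<close>

lemma fall_record:
  assumes \<sigma>: "\<sigma> permutes {1..N}" and x: "x \<in> {1..N}" "\<sigma> x < x"
  shows "\<not> is_record N \<sigma> x" "is_antirecord N \<sigma> x \<longleftrightarrow> lnest_at N \<sigma> x = 0"
proof -
  show "\<not> is_record N \<sigma> x"
  proof
    assume r: "is_record N \<sigma> x"
    have "\<sigma> ` {1..<x} \<subseteq> {1..<\<sigma> x}"
    proof
      fix y assume "y \<in> \<sigma> ` {1..<x}"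
      then obtain z where z: "z \<in> {1..<x}" "y = \<sigma> z" by auto
      then have "\<sigma> z < \<sigma> x" using r x unfolding is_record_def by auto
      moreover have "\<sigma> z \<in> {1..N}" using z x by (subst permutes_in_image[OF \<sigma>]) auto
      ultimately show "y \<in> {1..<\<sigma> x}" using z by auto
    qed
    then have "card (\<sigma> ` {1..<x}) \<le> card {1..<\<sigma> x}" by (intro card_mono) auto
    moreover have "card (\<sigma> ` {1..<x}) = x - 1"
      using permutes_inj_on[OF \<sigma>] by (subst card_image) auto
    moreover have "\<sigma> x \<in> {1..N}" using x(1) permutes_in_image[OF \<sigma>] by blast
    ultimately show False using x by auto
  qed
  have "\<sigma> j > \<sigma> x \<longleftrightarrow> \<not> \<sigma> x > \<sigma> j" if "x < j" for j
    using that injD[OF permutes_inj[OF \<sigma>], of j x] by (auto simp: not_less order_less_le)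
  then show "is_antirecord N \<sigma> x \<longleftrightarrow> lnest_at N \<sigma> x = 0"
    using x unfolding is_antirecord_def lnest_at_def by auto
qed

text \<open>The mirror image of the pigeonhole argument for falls: the \<open>N - x\<close> later
  points do not fit into the values above \<open>\<sigma> x\<close>.\<close>

lemma rise_record:
  assumes \<sigma>: "\<sigma> permutes {1..N}" and x: "x \<in> {1..N}" "x < \<sigma> x"
  shows "\<not> is_antirecord N \<sigma> x" "is_record N \<sigma> x \<longleftrightarrow> unest_at N \<sigma> x = 0"
proof -
  show "\<not> is_antirecord N \<sigma> x"
  proof
    assume r: "is_antirecord N \<sigma> x"
    have "\<sigma> ` {x<..N} \<subseteq> {\<sigma> x<..N}"
    proof
      fix y assume "y \<in> \<sigma> ` {x<..N}"
      then obtain z where z: "z \<in> {x<..N}" "y = \<sigma> z" by auto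
      then have "\<sigma> z > \<sigma> x" using r x unfolding is_antirecord_def by auto
      moreover have "\<sigma> z \<in> {1..N}" using z x by (subst permutes_in_image[OF \<sigma>]) auto
      ultimately show "y \<in> {\<sigma> x<..N}" using z by auto
    qed
    then have "card (\<sigma> ` {x<..N}) \<le> card {\<sigma> x<..N}" by (intro card_mono) auto
    moreover have "card (\<sigma> ` {x<..N}) = N - x"
      using permutes_inj_on[OF \<sigma>] by (subst card_image) auto
    moreover have "\<sigma> x \<in> {1..N}" using x(1) permutes_in_image[OF \<sigma>] by blast
    ultimately show False using x by auto
  qed
  have "\<sigma> j < \<sigma> x \<longleftrightarrow> \<not> \<sigma> x < \<sigma> j" if "j < x" for j
    using that injD[OF permutes_inj[OF \<sigma>], of j x] by (auto simp: not_less order_less_le)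
  then show "is_record N \<sigma> x \<longleftrightarrow> unest_at N \<sigma> x = 0"
    using x unfolding is_record_def unest_at_def by auto
qed

subsection \<open>Lower statistics\<close>

lemma low_lower_at:
  assumes "low \<sigma>"
  shows "lcross_at N \<sigma> x = 0" "lnest_at N \<sigma> x = 0"
proof -
  have "{j\<in>{1..N}. j > x \<and> x > \<sigma> j \<and> \<sigma> j > \<sigma> x} = {}"
    "{j\<in>{1..N}. j > x \<and> x > \<sigma> x \<and> \<sigma> x > \<sigma> j} = {}"
    using assms unfolding low_def by (fastforce simp del: One_nat_def)+
  then show "lcross_at N \<sigma> x = 0" "lnest_at N \<sigma> x = 0"
    unfolding lcross_at_def lnest_at_def by (simp_all only: card.empty)
qed

text \<open>As many arcs cross a given point upwards as downwards.\<close>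

lemma low_imp_rises_disjoint:
  assumes \<sigma>: "\<sigma> permutes {1..N}" and "low \<sigma>" and "i < j" "j < \<sigma> i"
  shows "\<sigma> j \<le> j"
proof (rule ccontr)
  assume j: "\<not> \<sigma> j \<le> j"
  have moved_in: "\<sigma> i \<noteq> i \<Longrightarrow> i \<in> {1..N}" for i
    using \<sigma> by (meson permutes_not_in)
  define A where "A = {x. x \<le> j \<and> j < \<sigma> x}"
  define B where "B = {x. j < x \<and> \<sigma> x \<le> j}"
  have fin: "finite A" "finite B" unfolding A_def B_def
    by (rule finite_subset[of _ "{1..N}"]; use moved_in in fastforce)+
  \<comment> \<open>\<open>C\<close> completes \<open>A\<close> to \<open>{..j}\<close> and
    completes \<open>B\<close> to the preimage of \<open>{..j}\<close>, so \<open>A\<close> and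
    \<open>B\<close> have the same size.\<close>
  define C where "C = {x. x \<le> j \<and> \<sigma> x \<le> j}"
  have finC: "finite C" unfolding C_def by simp
  have "A \<union> C = {..j}" "A \<inter> C = {}" unfolding A_def C_def by auto
  then have "card A + card C = card {..j}" using card_Un_disjoint[OF fin(1) finC] by simp
  moreover have "card B + card C = card {..j}"
  proof -
    have "\<sigma> ` (B \<union> C) = {..j}"
    proof
      show "\<sigma> ` (B \<union> C) \<subseteq> {..j}" unfolding B_def C_def by auto
      show "{..j} \<subseteq> \<sigma> ` (B \<union> C)"
      proof
        fix y assume "y \<in> {..j}"
        moreover have "\<sigma> (inv \<sigma> y) = y" using permutes_inverses(1)[OF \<sigma>] .
        ultimately have "inv \<sigma> y \<in> B \<union> C" unfolding B_def C_def by auto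
        then show "y \<in> \<sigma> ` (B \<union> C)" using \<open>\<sigma> (inv \<sigma> y) = y\<close> by (metis imageI)
      qed
    qed
    then have "card (B \<union> C) = card {..j}"
      using card_image[OF permutes_inj_on[OF \<sigma>, of "B \<union> C"]] by simp
    moreover have "B \<inter> C = {}" unfolding B_def C_def by auto
    ultimately show ?thesis using card_Un_disjoint[OF fin(2) finC] by simp
  qed
  ultimately have "card A = card B" by simp
  moreover have "{i, j} \<subseteq> A" using assms j unfolding A_def by auto
  then have "card {i, j} \<le> card A" using fin by (intro card_mono) auto
  \<comment> \<open>Two upward arcs pass over the gap above \<open>j\<close>, hence so do two
    downward arcs. They contradict lowness at the smaller of their two sources.\<close>
  ultimately have "card B \<ge> 2" using \<open>i < j\<close> by simp
  then obtain p q where "p \<in> B" "q \<in> B" "p < q"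
    by (metis card_2_iff' linorder_neqE_nat obtain_subset_with_card_n subsetD)
  then have "\<sigma> p < p" "\<sigma> q < p" unfolding B_def by auto
  then show False using \<open>low \<sigma>\<close> \<open>p < q\<close> unfolding low_def by (meson not_le)
qed

lemma low_upper_at:
  assumes "\<sigma> permutes {1..N}" "low \<sigma>"
  shows "ucross_at N \<sigma> x = 0" "unest_at N \<sigma> x = 0"
proof -
  have "{j\<in>{1..N}. j < x \<and> x < \<sigma> j \<and> \<sigma> j < \<sigma> x} = {}"
    "{j\<in>{1..N}. j < x \<and> x < \<sigma> x \<and> \<sigma> x < \<sigma> j} = {}"
    using low_imp_rises_disjoint[OF assms, of _ x] by (fastforce simp del: One_nat_def)+
  then show "ucross_at N \<sigma> x = 0" "unest_at N \<sigma> x = 0"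
    unfolding ucross_at_def unest_at_def by (simp_all only: card.empty)
qed

section \<open>Statistics that change parity under the swap\<close>

lemma card_filter_eq_sum: "finite A \<Longrightarrow> card {x\<in>A. P x} = (\<Sum>x\<in>A. of_bool (P x))"
  by (simp add: of_bool_def sum.If_cases Int_def)

lemma finite_cycle_types [simp]:
  "finite (cycle_peaks N \<sigma>)" "finite (cycle_valleys N \<sigma>)"
  "finite (cycle_double_rises N \<sigma>)" "finite (cycle_double_falls N \<sigma>)"
  unfolding cycle_peaks_def cycle_valleys_def cycle_double_rises_def cycle_double_falls_def
  by simp_all

text \<open>Written as sums of nesting indicators, these counts can be followed term by term under
  the swap and under reversal.\<close>

lemma nrc_eq_sum_nest:
  assumes \<sigma>: "\<sigma> permutes {1..N}"
  shows "nrcpeak N \<sigma> = (\<Sum>x\<in>cycle_peaks N \<sigma>. of_bool (lnest_at N \<sigma> x \<noteq> 0))"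
    "nrcdfall N \<sigma> = (\<Sum>x\<in>cycle_double_falls N \<sigma>. of_bool (lnest_at N \<sigma> x \<noteq> 0))"
    "nrcval N \<sigma> = (\<Sum>x\<in>cycle_valleys N \<sigma>. of_bool (unest_at N \<sigma> x \<noteq> 0))"
    "nrcdrise N \<sigma> = (\<Sum>x\<in>cycle_double_rises N \<sigma>. of_bool (unest_at N \<sigma> x \<noteq> 0))"
proof -
  have f: "\<not> is_record N \<sigma> x \<and> \<not> is_antirecord N \<sigma> x \<longleftrightarrow> lnest_at N \<sigma> x \<noteq> 0"
    if "x \<in> cycle_peaks N \<sigma> \<union> cycle_double_falls N \<sigma>" for x
    using that fall_record[OF \<sigma>, of x] unfolding cycle_peaks_def cycle_double_falls_def by auto
  have r: "\<not> is_record N \<sigma> x \<and> \<not> is_antirecord N \<sigma> x \<longleftrightarrow> unest_at N \<sigma> x \<noteq> 0"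
    if "x \<in> cycle_valleys N \<sigma> \<union> cycle_double_rises N \<sigma>" for x
    using that rise_record[OF \<sigma>, of x] unfolding cycle_valleys_def cycle_double_rises_def by auto
  show "nrcpeak N \<sigma> = (\<Sum>x\<in>cycle_peaks N \<sigma>. of_bool (lnest_at N \<sigma> x \<noteq> 0))"
    "nrcdfall N \<sigma> = (\<Sum>x\<in>cycle_double_falls N \<sigma>. of_bool (lnest_at N \<sigma> x \<noteq> 0))"
    unfolding nrcpeak_def nrcdfall_def
    by (subst card_filter_eq_sum, simp, rule sum.cong, simp, subst f, simp, simp)+
  show "nrcval N \<sigma> = (\<Sum>x\<in>cycle_valleys N \<sigma>. of_bool (unest_at N \<sigma> x \<noteq> 0))"
    "nrcdrise N \<sigma> = (\<Sum>x\<in>cycle_double_rises N \<sigma>. of_bool (unest_at N \<sigma> x \<noteq> 0))"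
    unfolding nrcval_def nrcdrise_def
    by (subst card_filter_eq_sum, simp, rule sum.cong, simp, subst r, simp, simp)+
qed

text \<open>These two properties make the signed sum over a family closed under the swap equal to
  the number of its low members.\<close>

definition lower_stat :: "nat \<Rightarrow> ((nat \<Rightarrow> nat) \<Rightarrow> nat) \<Rightarrow> bool" where
  "lower_stat N s \<longleftrightarrow> (\<forall>\<sigma>. \<sigma> permutes {1..N} \<longrightarrow>
     (if low \<sigma> then s \<sigma> = 0 else even (s (swap_pivot \<sigma>)) = odd (s \<sigma>)))"

lemma lower_statI:
  assumes "\<And>\<sigma>. \<sigma> permutes {1..N} \<Longrightarrow> low \<sigma> \<Longrightarrow> s \<sigma> = 0"
    and "\<And>\<sigma>. high_permutation N \<sigma> \<Longrightarrow> even (s (swap_pivot \<sigma>)) = odd (s \<sigma>)"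
  shows "lower_stat N s"
  using assms unfolding lower_stat_def high_permutation_def by auto

context high_permutation
begin

text \<open>Each statistic is a sum over a set that contains the peak \<open>p\<close>. Only the
  term at \<open>p\<close> changes, from 0 to 1 or back.\<close>

lemma swap_parity:
  "even (lcross N \<tau>) = odd (lcross N \<sigma>)" "even (lnest N \<tau>) = odd (lnest N \<sigma>)"
  "even (lcrosscpeak N \<tau>) = odd (lcrosscpeak N \<sigma>)"
  "even (lnestcpeak N \<tau>) = odd (lnestcpeak N \<sigma>)"
  "even (nrcpeak N \<tau>) = odd (nrcpeak N \<sigma>)"
  unfolding lcross_def lnest_def lcrosscpeak_def lnestcpeak_def nrc_eq_sum_nest[OF perm]
    nrc_eq_sum_nest[OF swap_permutes] swap_cycle_types
  by (rule swap_sum_parity; use swap_lower_at swap_lower_at_pivot in_range pivot_peak in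
      \<open>simp add: of_bool_def\<close>)+

text \<open>These are the remaining summands of the combined statistics. As they do not change, the
  total changes parity together with its one lower summand from \<open>swap_parity\<close>.\<close>

lemma swap_invariant:
  "ucross N \<tau> = ucross N \<sigma>" "unest N \<tau> = unest N \<sigma>"
  "nrcval N \<tau> = nrcval N \<sigma>" "nrcdrise N \<tau> = nrcdrise N \<sigma>" "nrcdfall N \<tau> = nrcdfall N \<sigma>"
proof -
  show "ucross N \<tau> = ucross N \<sigma>" "unest N \<tau> = unest N \<sigma>"
    "nrcval N \<tau> = nrcval N \<sigma>" "nrcdrise N \<tau> = nrcdrise N \<sigma>"
    unfolding ucross_def unest_def nrc_eq_sum_nest[OF perm]
      nrc_eq_sum_nest[OF swap_permutes] swap_cycle_types swap_upper_at by (rule refl)+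
  \<comment> \<open>The pivot is a peak, so the only nesting count that the swap alters does not
    occur in this sum.\<close>
  have "p \<notin> cycle_double_falls N \<sigma>"
    using inv_pivot unfolding cycle_double_falls_def by simp
  then show "nrcdfall N \<tau> = nrcdfall N \<sigma>"
    unfolding nrc_eq_sum_nest[OF perm] nrc_eq_sum_nest[OF swap_permutes] swap_cycle_types
    by (intro sum.cong refl) (metis swap_lower_at(2))
qed

end

lemma lower_stats:
  "lower_stat N (nrcpeak N)"
  "lower_stat N (\<lambda>\<sigma>. nrcpeak N \<sigma> + nrcval N \<sigma> + nrcdrise N \<sigma> + nrcdfall N \<sigma>)"
  "lower_stat N (lcrosscpeak N)"
  "lower_stat N (lnestcpeak N)"
  "lower_stat N (lcross N)"
  "lower_stat N (lnest N)"
  "lower_stat N (\<lambda>\<sigma>. ucross N \<sigma> + lcross N \<sigma>)"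
  "lower_stat N (\<lambda>\<sigma>. unest N \<sigma> + lnest N \<sigma>)"
  by (rule lower_statI,
      simp add: nrc_eq_sum_nest low_lower_at low_upper_at lcrosscpeak_def lnestcpeak_def
        lcross_def lnest_def ucross_def unest_def,
      force simp: high_permutation.swap_parity high_permutation.swap_invariant)+

text \<open>On the members that are not low the swap is a sign-reversing involution, so their sum
  equals its own negative. Every low member contributes 1.\<close>

lemma sign_sum_lower_stat:
  assumes s: "lower_stat N s" and fin: "finite X"
    and X: "\<And>\<sigma>. \<sigma> \<in> X \<Longrightarrow> \<sigma> permutes {1..N}"
    and closed: "\<And>\<sigma>. \<sigma> \<in> X \<Longrightarrow> \<not> low \<sigma> \<Longrightarrow> swap_pivot \<sigma> \<in> X"
  shows "(\<Sum>\<sigma>\<in>X. (-1) ^ s \<sigma>) = (int (card {\<sigma>\<in>X. low \<sigma>}))"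
proof -
  define H where "H = {\<sigma>\<in>X. \<not> low \<sigma>}"
  have hp: "high_permutation N \<sigma>" if "\<sigma> \<in> H" for \<sigma>
    using that X unfolding H_def high_permutation_def by auto
  have mem: "swap_pivot \<sigma> \<in> H" if "\<sigma> \<in> H" for \<sigma>
    using high_permutation.swap_high[OF hp[OF that]] closed that
    unfolding H_def high_permutation_def by auto
  have "(\<Sum>\<sigma>\<in>H. (-1) ^ s \<sigma>) = (\<Sum>\<sigma>\<in>H. - ((-1 :: int) ^ s \<sigma>))"
  proof (rule sum.reindex_bij_witness[of _ swap_pivot swap_pivot])
    fix \<sigma> assume \<sigma>: "\<sigma> \<in> H"
    show "- ((-1) ^ s (swap_pivot \<sigma>)) = (-1 :: int) ^ s \<sigma>"
      using s \<sigma> X unfolding lower_stat_def H_def by (cases "even (s \<sigma>)") auto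
  qed (auto simp: mem high_permutation.swap_swap[OF hp])
  then have "(\<Sum>\<sigma>\<in>H. (-1 :: int) ^ s \<sigma>) = 0" by (simp add: sum_negf)
  moreover have "(\<Sum>\<sigma>\<in>{\<sigma>\<in>X. low \<sigma>}. (-1 :: int) ^ s \<sigma>) = int (card {\<sigma>\<in>X. low \<sigma>})"
    using s X unfolding lower_stat_def by simp
  moreover have "(\<Sum>\<sigma>\<in>X. (-1 :: int) ^ s \<sigma>)
      = (\<Sum>\<sigma>\<in>{\<sigma>\<in>X. low \<sigma>}. (-1) ^ s \<sigma>) + (\<Sum>\<sigma>\<in>H. (-1) ^ s \<sigma>)"
    unfolding H_def using fin by (subst sum.union_disjoint[symmetric]) (auto intro!: sum.cong)
  ultimately show ?thesis by simp
qed

subsection \<open>Reversal\<close>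

text \<open>The reversal is extended by the identity outside \<open>{1..N}\<close>, so that
  conjugating with it maps permutations of \<open>{1..N}\<close> to such permutations.\<close>

definition flip :: "nat \<Rightarrow> nat \<Rightarrow> nat" where
  "flip N x = (if x \<in> {1..N} then N + 1 - x else x)"

definition flip_conj :: "nat \<Rightarrow> (nat \<Rightarrow> nat) \<Rightarrow> nat \<Rightarrow> nat" where
  "flip_conj N \<sigma> = flip N \<circ> \<sigma> \<circ> flip N"

lemma flip_flip [simp]: "flip N (flip N x) = x"
  unfolding flip_def by auto

lemma flip_in: "flip N x \<in> {1..N} \<longleftrightarrow> x \<in> {1..N}"
  unfolding flip_def by auto

lemmas flip_in_Suc [simp] = flip_in[unfolded One_nat_def]

lemma bij_betw_flip: "bij_betw (flip N) {x\<in>{1..N}. P x} {x\<in>{1..N}. P (flip N x)}"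
  by (rule bij_betw_byWitness[where f' = "flip N"]) (simp_all add: image_subset_iff del: atLeastAtMost_iff)

lemma flip_permutes: "flip N permutes {1..N}"
proof (rule bij_imp_permutes)
  show "bij_betw (flip N) {1..N} {1..N}"
    by (rule bij_betw_byWitness[where f' = "flip N"])
      (simp_all add: image_subset_iff del: atLeastAtMost_iff)
qed (auto simp: flip_def)

lemma flip_conj_permutes: "\<sigma> permutes {1..N} \<Longrightarrow> flip_conj N \<sigma> permutes {1..N}"
  unfolding flip_conj_def by (intro permutes_compose flip_permutes)

lemma flip_conj_flip_conj [simp]: "flip_conj N (flip_conj N \<sigma>) = \<sigma>"
  unfolding flip_conj_def by (simp add: fun_eq_iff)

lemma flip_conj_flip [simp]: "flip_conj N \<sigma> (flip N x) = flip N (\<sigma> x)"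
  unfolding flip_conj_def by simp

lemma inv_flip_conj:
  assumes "\<sigma> permutes {1..N}"
  shows "inv (flip_conj N \<sigma>) (flip N x) = flip N (inv \<sigma> x)"
proof -
  have "flip_conj N \<sigma> (flip N (inv \<sigma> x)) = flip N x"
    using permutes_inverses(1)[OF assms] by simp
  then show ?thesis
    using permutes_inverses(2)[OF flip_conj_permutes[OF assms]] by metis
qed

lemma card_flip: "card {x\<in>{1..N}. P (flip N x)} = card {x\<in>{1..N}. P x}"
  using bij_betw_same_card[OF bij_betw_flip] by metis

lemma flip_less_flip: "x \<in> {1..N} \<Longrightarrow> y \<in> {1..N} \<Longrightarrow> flip N x < flip N y \<longleftrightarrow> y < x"
  unfolding flip_def by auto

context
  fixes N :: nat and \<sigma> :: "nat \<Rightarrow> nat"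
  assumes \<sigma>: "\<sigma> permutes {1..N}"
begin

lemma perm_in: "\<sigma> x \<in> {1..N} \<longleftrightarrow> x \<in> {1..N}"
  by (rule permutes_in_image[OF \<sigma>])

lemma inv_perm_in: "inv \<sigma> x \<in> {1..N} \<longleftrightarrow> x \<in> {1..N}"
  by (rule permutes_in_image[OF permutes_inv[OF \<sigma>]])

lemma lower_at_flip:
  assumes x: "x \<in> {1..N}"
  shows "lcross_at N (flip_conj N \<sigma>) (flip N x) = ucross_at N \<sigma> x"
    "lnest_at N (flip_conj N \<sigma>) (flip N x) = unest_at N \<sigma> x"
proof -
  let ?P = "\<lambda>j. j < x \<and> x < \<sigma> j \<and> \<sigma> j < \<sigma> x"
  let ?Q = "\<lambda>j. j < x \<and> x < \<sigma> x \<and> \<sigma> x < \<sigma> j"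
  have "flip N x < j \<and> flip_conj N \<sigma> j < flip N x \<and> flip_conj N \<sigma> (flip N x) < flip_conj N \<sigma> j
      \<longleftrightarrow> ?P (flip N j)"
    "flip N x < j \<and> flip_conj N \<sigma> (flip N x) < flip N x \<and> flip_conj N \<sigma> j < flip_conj N \<sigma> (flip N x)
      \<longleftrightarrow> ?Q (flip N j)"
    if j: "j \<in> {1..N}" for j
  proof -
    \<comment> \<open>With every index and image written as the flip of a point of
      \<open>{1..N}\<close>, each inequality simply turns round.\<close>
    define k where "k = flip N j"
    have k: "j = flip N k" "k \<in> {1..N}" using j unfolding k_def by (simp_all del: atLeastAtMost_iff)
    have "\<sigma> k \<in> {1..N}" "\<sigma> x \<in> {1..N}" using perm_in x k(2) by blast+
    then show
      "flip N x < j \<and> flip_conj N \<sigma> j < flip N x \<and> flip_conj N \<sigma> (flip N x) < flip_conj N \<sigma> j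
        \<longleftrightarrow> ?P (flip N j)"
      "flip N x < j \<and> flip_conj N \<sigma> (flip N x) < flip N x \<and> flip_conj N \<sigma> j < flip_conj N \<sigma> (flip N x)
        \<longleftrightarrow> ?Q (flip N j)"
      using x k(2) unfolding k(1) by (simp_all add: flip_less_flip del: atLeastAtMost_iff)
  qed
  note * = this
  show "lcross_at N (flip_conj N \<sigma>) (flip N x) = ucross_at N \<sigma> x"
    unfolding lcross_at_def ucross_at_def card_flip[of N ?P, symmetric]
    by (rule arg_cong[of _ _ card], rule Collect_cong, rule conj_cong[OF refl], rule *)
  show "lnest_at N (flip_conj N \<sigma>) (flip N x) = unest_at N \<sigma> x"
    unfolding lnest_at_def unest_at_def card_flip[of N ?Q, symmetric]
    by (rule arg_cong[of _ _ card], rule Collect_cong, rule conj_cong[OF refl], rule *)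
qed

lemma flip_in_peaks: "flip N x \<in> cycle_peaks N (flip_conj N \<sigma>) \<longleftrightarrow> x \<in> cycle_valleys N \<sigma>"
proof (cases "x \<in> {1..N}")
  case True
  moreover have "\<sigma> x \<in> {1..N}" "inv \<sigma> x \<in> {1..N}" using True perm_in inv_perm_in by blast+
  ultimately show ?thesis
    unfolding cycle_peaks_def cycle_valleys_def
    by (simp add: inv_flip_conj[OF \<sigma>] flip_less_flip del: atLeastAtMost_iff)
qed (simp add: cycle_peaks_def cycle_valleys_def del: atLeastAtMost_iff)

lemma upper_stats_flip:
  "ucross N \<sigma> = lcross N (flip_conj N \<sigma>)"
  "unest N \<sigma> = lnest N (flip_conj N \<sigma>)"
  "ucrosscval N \<sigma> = lcrosscpeak N (flip_conj N \<sigma>)"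
  "unestcval N \<sigma> = lnestcpeak N (flip_conj N \<sigma>)"
  "nrcval N \<sigma> = nrcpeak N (flip_conj N \<sigma>)"
proof -
  have all: "sum f {1..N} = sum g {1..N}"
    if "\<And>x. x \<in> {1..N} \<Longrightarrow> g (flip N x) = f x" for f g :: "nat \<Rightarrow> nat"
    by (rule sum.reindex_bij_witness[of _ "flip N" "flip N"])
      (use that in \<open>simp_all del: atLeastAtMost_iff\<close>)
  show "ucross N \<sigma> = lcross N (flip_conj N \<sigma>)" "unest N \<sigma> = lnest N (flip_conj N \<sigma>)"
    unfolding ucross_def lcross_def unest_def lnest_def by (rule all, erule lower_at_flip)+
  have vals: "sum f (cycle_valleys N \<sigma>) = sum g (cycle_peaks N (flip_conj N \<sigma>))"
    if "\<And>x. x \<in> {1..N} \<Longrightarrow> g (flip N x) = f x" for f g :: "nat \<Rightarrow> nat"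
  proof (rule sum.reindex_bij_witness[of _ "flip N" "flip N"])
    fix x assume "x \<in> cycle_valleys N \<sigma>"
    then show "flip N x \<in> cycle_peaks N (flip_conj N \<sigma>)" "g (flip N x) = f x"
      using flip_in_peaks that unfolding cycle_valleys_def by auto
  next
    fix x assume "x \<in> cycle_peaks N (flip_conj N \<sigma>)"
    then show "flip N x \<in> cycle_valleys N \<sigma>" using flip_in_peaks[of "flip N x"] by simp
  qed simp_all
  show "ucrosscval N \<sigma> = lcrosscpeak N (flip_conj N \<sigma>)"
    "unestcval N \<sigma> = lnestcpeak N (flip_conj N \<sigma>)"
    "nrcval N \<sigma> = nrcpeak N (flip_conj N \<sigma>)"
    unfolding ucrosscval_def lcrosscpeak_def unestcval_def lnestcpeak_def nrc_eq_sum_nest[OF \<sigma>]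
      nrc_eq_sum_nest[OF flip_conj_permutes[OF \<sigma>]]
    by (rule vals, simp only: lower_at_flip)+
qed

text \<open>A failure of lowness after reversal reflects to two upward arcs open just above one
  point, which \<open>low_imp_rises_disjoint\<close> excludes.\<close>

lemma low_flip_conj:
  assumes "low \<sigma>"
  shows "low (flip_conj N \<sigma>)"
  unfolding low_def
proof (intro allI impI, rule ccontr)
  fix i j assume ij: "i < j" "flip_conj N \<sigma> i < i" "\<not> i \<le> flip_conj N \<sigma> j"
  have "x \<in> {1..N}" if "flip_conj N \<sigma> x \<noteq> x" for x
    using that permutes_not_in[OF flip_conj_permutes[OF \<sigma>]] by blast
  then have "i \<in> {1..N}" "j \<in> {1..N}" using ij by fastforce+
  moreover define i' j' where "i' = flip N i" and "j' = flip N j"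
  ultimately have i: "i = flip N i'" "i' \<in> {1..N}" and j: "j = flip N j'" "j' \<in> {1..N}"
    by (simp_all del: atLeastAtMost_iff)
  have "\<sigma> i' \<in> {1..N}" "\<sigma> j' \<in> {1..N}" using perm_in i(2) j(2) by blast+
  then have "j' < i'" "i' < \<sigma> i'" "i' < \<sigma> j'"
    using ij i(2) j(2) unfolding i(1) j(1)
    by (simp_all add: flip_less_flip not_le del: atLeastAtMost_iff)
  then show False using low_imp_rises_disjoint[OF \<sigma> assms] by fastforce
qed

end

section \<open>D-permutations and semiderangements under reversal\<close>

lemma mem_D_permutations:
  "\<sigma> \<in> D_permutations n \<longleftrightarrow> \<sigma> permutes {1..2*n} \<and>
     (\<forall>i\<in>{1..2*n}. if odd i then i \<le> \<sigma> i else \<sigma> i \<le> i)"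
proof -
  have "(\<forall>i\<in>{1..2*n}. if odd i then i \<le> \<sigma> i else \<sigma> i \<le> i) \<longleftrightarrow>
    (\<forall>k\<in>{1..n}. \<sigma> (2*k - 1) \<ge> 2*k - 1 \<and> \<sigma> (2*k) \<le> 2*k)" (is "?L \<longleftrightarrow> ?R")
  proof
    assume L: ?L
    show ?R
    proof
      fix k assume "k \<in> {1..n}"
      then show "\<sigma> (2*k - 1) \<ge> 2*k - 1 \<and> \<sigma> (2*k) \<le> 2*k"
        using L[rule_format, of "2*k - 1"] L[rule_format, of "2*k"] by fastforce
    qed
  next
    assume R: ?R
    show ?L
    proof
      fix i assume i: "i \<in> {1..2*n}"
      show "if odd i then i \<le> \<sigma> i else \<sigma> i \<le> i"
      proof (cases "odd i")
        case True
        then obtain k where "i = 2*k + 1" by (elim oddE)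
        then show ?thesis using R[rule_format, of "k + 1"] i by auto
      next
        case False
        then obtain k where "i = 2*k" by (auto elim: evenE)
        then show ?thesis using R[rule_format, of k] i by auto
      qed
    qed
  qed
  then show ?thesis unfolding D_permutations_def by simp
qed

lemma flip_conj_D_permutations:
  assumes "\<sigma> \<in> D_permutations n"
  shows "flip_conj (2*n) \<sigma> \<in> D_permutations n"
proof -
  have p: "\<sigma> permutes {1..2*n}" using assms mem_D_permutations by simp
  have "if odd i then i \<le> flip_conj (2*n) \<sigma> i else flip_conj (2*n) \<sigma> i \<le> i"
    if i: "i \<in> {1..2*n}" for i
  proof -
    define k where "k = flip (2*n) i"
    have k: "k \<in> {1..2*n}" "i = flip (2*n) k" using i unfolding k_def by (simp_all del: atLeastAtMost_iff)
    \<comment> \<open>Since \<open>2*n + 1\<close> is odd, reversal changes parity; as it also turns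
      inequalities round, the conditions at odd and even points are exchanged.\<close>
    have "odd i \<longleftrightarrow> even k" using k i unfolding flip_def by auto
    moreover have "if odd k then k \<le> \<sigma> k else \<sigma> k \<le> k" using assms k mem_D_permutations by blast
    moreover have "\<sigma> k \<in> {1..2*n}" by (subst permutes_in_image[OF p]) (rule k(1))
    ultimately show ?thesis
      using k(1) unfolding k(2) flip_conj_flip by (auto simp: flip_def)
  qed
  then show ?thesis using flip_conj_permutes[OF p] mem_D_permutations by blast
qed

lemma flip_conj_semiderangements:
  "\<sigma> \<in> D_e_semiderangements n \<Longrightarrow> flip_conj (2*n) \<sigma> \<in> D_o_semiderangements n"
  "\<sigma> \<in> D_o_semiderangements n \<Longrightarrow> flip_conj (2*n) \<sigma> \<in> D_e_semiderangements n"
  "\<sigma> \<in> D_derangements n \<Longrightarrow> flip_conj (2*n) \<sigma> \<in> D_derangements n"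
proof -
  have fix_iff: "flip_conj (2*n) \<sigma> i = i \<longleftrightarrow> \<sigma> (flip (2*n) i) = flip (2*n) i" for \<sigma> i
    unfolding flip_conj_def by (metis comp_apply flip_flip)
  have moved: "\<forall>i\<in>{1..2*n}. Q (flip (2*n) i) \<longrightarrow> flip_conj (2*n) \<sigma> i \<noteq> i"
    if "\<forall>i\<in>{1..2*n}. Q i \<longrightarrow> \<sigma> i \<noteq> i" for \<sigma> Q
    using that unfolding fix_iff by (meson flip_in)
  have par: "odd (flip (2*n) i) \<longleftrightarrow> even i" if "i \<in> {1..2*n}" for i
    using that unfolding flip_def by auto
  show "flip_conj (2*n) \<sigma> \<in> D_o_semiderangements n" if "\<sigma> \<in> D_e_semiderangements n"
    using that moved[of even \<sigma>] flip_conj_D_permutations par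
    unfolding D_e_semiderangements_def D_o_semiderangements_def by blast
  show "flip_conj (2*n) \<sigma> \<in> D_e_semiderangements n" if "\<sigma> \<in> D_o_semiderangements n"
    using that moved[of odd \<sigma>] flip_conj_D_permutations par
    unfolding D_e_semiderangements_def D_o_semiderangements_def by blast
  show "flip_conj (2*n) \<sigma> \<in> D_derangements n" if "\<sigma> \<in> D_derangements n"
    using that moved[of "\<lambda>_. True" \<sigma>] flip_conj_D_permutations
    unfolding D_derangements_def by blast
qed

subsection \<open>Counting permutations of height at most one\<close>

text \<open>The flag permits even fixed points, so one recursion serves o-semiderangements
  (\<open>True\<close>) and derangements (\<open>False\<close>). The e-semiderangements are reached
  by reversal.\<close>

definition low_semiderangements :: "bool \<Rightarrow> nat \<Rightarrow> (nat \<Rightarrow> nat) set" where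
  "low_semiderangements b n = {\<sigma>. \<sigma> permutes {1..2*n} \<and> low \<sigma> \<and>
     (\<forall>i\<in>{1..2*n}. if odd i then i < \<sigma> i else \<sigma> i \<le> i \<and> (b \<or> \<sigma> i \<noteq> i))}"

lemma low_D_o_semiderangements:
  "{\<sigma> \<in> D_o_semiderangements n. low \<sigma>} = low_semiderangements True n"
proof -
  have "(if odd i then i < \<sigma> i else \<sigma> i \<le> i \<and> (True \<or> \<sigma> i \<noteq> i)) \<longleftrightarrow>
      (if odd i then i \<le> \<sigma> i else \<sigma> i \<le> i) \<and> (odd i \<longrightarrow> \<sigma> i \<noteq> i)" for i and \<sigma> :: "nat \<Rightarrow> nat"
    by auto
  then show ?thesis
    unfolding D_o_semiderangements_def low_semiderangements_def mem_D_permutations by blast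
qed

lemma low_D_derangements:
  "{\<sigma> \<in> D_derangements n. low \<sigma>} = low_semiderangements False n"
proof -
  have "(if odd i then i < \<sigma> i else \<sigma> i \<le> i \<and> (False \<or> \<sigma> i \<noteq> i)) \<longleftrightarrow>
      (if odd i then i \<le> \<sigma> i else \<sigma> i \<le> i) \<and> \<sigma> i \<noteq> i" for i and \<sigma> :: "nat \<Rightarrow> nat"
    by auto
  then show ?thesis
    unfolding D_derangements_def low_semiderangements_def mem_D_permutations by blast
qed

section \<open>The recursion from [2n] to [2n+2]\<close>

context
  fixes m n :: nat
  assumes m: "m = 2 * n" and n: "n \<ge> 1"
begin

text \<open>The odd point \<open>m - 1\<close> has to rise, and \<open>m\<close> is the only larger
  value. No other point can then map to \<open>m\<close>, so \<open>m\<close> falls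
  strictly.\<close>

lemma low_last:
  assumes "\<tau> \<in> low_semiderangements b n"
  shows "\<tau> permutes {1..m}" "low \<tau>" "\<And>x. m < x \<Longrightarrow> \<tau> x = x" "\<tau> (m - 1) = m" "\<tau> m < m"
    "\<And>x. x \<noteq> m - 1 \<Longrightarrow> \<tau> x \<noteq> m" "\<And>x. x \<le> m \<Longrightarrow> \<tau> x \<le> m"
    "\<And>i. i \<in> {1..m} \<Longrightarrow> if odd i then i < \<tau> i else \<tau> i \<le> i \<and> (b \<or> \<tau> i \<noteq> i)"
proof -
  show p: "\<tau> permutes {1..m}" and "low \<tau>" using assms unfolding low_semiderangements_def m by auto
  show ok: "if odd i then i < \<tau> i else \<tau> i \<le> i \<and> (b \<or> \<tau> i \<noteq> i)" if "i \<in> {1..m}" for i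
    using assms that unfolding low_semiderangements_def m by blast
  show out: "\<tau> x = x" if "m < x" for x using that by (intro permutes_not_in[OF p]) auto
  have "m - 1 \<in> {1..m}" "odd (m - 1)" using m n by auto
  then have "m - 1 < \<tau> (m - 1)" using ok[of "m - 1"] by simp
  moreover have "\<tau> (m - 1) \<in> {1..m}" using \<open>m - 1 \<in> {1..m}\<close> permutes_in_image[OF p] by blast
  ultimately show *: "\<tau> (m - 1) = m" by auto
  show **: "\<tau> x \<noteq> m" if "x \<noteq> m - 1" for x
    using that * injD[OF permutes_inj[OF p], of x "m - 1"] by auto
  show in_le: "\<tau> x \<le> m" if "x \<le> m" for x
  proof (cases "x \<in> {1..m}")
    case True
    then have "\<tau> x \<in> {1..m}" using permutes_in_image[OF p] by blast
    then show ?thesis by simp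
  next
    case False
    then show ?thesis using permutes_not_in[OF p] that by simp
  qed
  have "m \<noteq> m - 1" using m n by auto
  then show "\<tau> m < m" using **[of m] in_le[of m] by simp
qed

text \<open>The same argument applied to the top pair \<open>m + 1\<close>, \<open>m + 2\<close>.
  Here \<open>m - 1\<close> has two possible images, \<open>m\<close> and
  \<open>m + 1\<close>.\<close>

lemma low_next_last:
  assumes "\<sigma> \<in> low_semiderangements b (n + 1)"
  shows "\<sigma> permutes {1..m+2}" "low \<sigma>" "\<And>x. m + 2 < x \<Longrightarrow> \<sigma> x = x" "\<sigma> (m + 1) = m + 2"
    "\<sigma> (m + 2) \<le> m + 1" "m - 1 < \<sigma> (m - 1)" "\<sigma> (m - 1) \<le> m + 1" "\<sigma> m \<le> m"
    "\<And>x. x \<noteq> m + 1 \<Longrightarrow> x \<le> m + 2 \<Longrightarrow> \<sigma> x \<le> m + 1"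
    "\<And>i. i \<in> {1..m+2} \<Longrightarrow> if odd i then i < \<sigma> i else \<sigma> i \<le> i \<and> (b \<or> \<sigma> i \<noteq> i)"
proof -
  show p: "\<sigma> permutes {1..m+2}" and "low \<sigma>"
    using assms unfolding low_semiderangements_def m by auto
  show ok: "if odd i then i < \<sigma> i else \<sigma> i \<le> i \<and> (b \<or> \<sigma> i \<noteq> i)" if "i \<in> {1..m+2}" for i
    using assms that unfolding low_semiderangements_def m by auto
  show out: "\<sigma> x = x" if "m + 2 < x" for x using that by (intro permutes_not_in[OF p]) auto
  have "m + 1 \<in> {1..m+2}" "odd (m + 1)" using m n by auto
  then have "m + 1 < \<sigma> (m + 1)" using ok[of "m + 1"] by simp
  moreover have "\<sigma> (m + 1) \<in> {1..m+2}" using \<open>m + 1 \<in> {1..m+2}\<close> permutes_in_image[OF p] by blast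
  ultimately show *: "\<sigma> (m + 1) = m + 2" by auto
  show le: "\<sigma> x \<le> m + 1" if "x \<noteq> m + 1" "x \<le> m + 2" for x
  proof (cases "x \<in> {1..m+2}")
    case True
    then have "\<sigma> x \<in> {1..m+2}" using permutes_in_image[OF p] by blast
    moreover have "\<sigma> x \<noteq> m + 2" using that * injD[OF permutes_inj[OF p], of x "m + 1"] by auto
    ultimately show ?thesis by simp
  next
    case False
    then show ?thesis using permutes_not_in[OF p] that by simp
  qed
  show "\<sigma> (m + 2) \<le> m + 1" "\<sigma> (m - 1) \<le> m + 1" by (rule le; simp)+
  show "m - 1 < \<sigma> (m - 1)"
  proof -
    have "m - 1 \<in> {1..m+2}" "odd (m - 1)" using m n by auto
    then show ?thesis using ok[of "m - 1"] by simp
  qed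
  show "\<sigma> m \<le> m" using ok[of m] m n by auto
qed

lemma mem_lowI:
  assumes "low \<tau>" "\<tau> permutes {1..m}"
    "\<And>i. i \<in> {1..m} \<Longrightarrow> if odd i then i < \<tau> i else \<tau> i \<le> i \<and> (b \<or> \<tau> i \<noteq> i)"
  shows "\<tau> \<in> low_semiderangements b n"
  using assms unfolding low_semiderangements_def m by blast

lemma mem_low_nextI:
  assumes "low \<sigma>" "\<sigma> permutes {1..m+2}"
    "\<And>i. i \<in> {1..m+2} \<Longrightarrow> if odd i then i < \<sigma> i else \<sigma> i \<le> i \<and> (b \<or> \<sigma> i \<noteq> i)"
  shows "\<sigma> \<in> low_semiderangements b (n + 1)"
  using assms unfolding low_semiderangements_def m by auto

text \<open>This is the 3-cycle \<open>m\<close>, \<open>m + 1\<close>, \<open>m + 2\<close>.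
  Composed on the left, it redirects the arc that ends in \<open>m\<close> to \<open>m + 1\<close>
  and turns the fixed points \<open>m + 1\<close>, \<open>m + 2\<close> into the arcs that continue
  to \<open>m + 2\<close> and \<open>m\<close>.\<close>

definition rot :: "nat \<Rightarrow> nat" where
  "rot = transpose m (m + 1) \<circ> transpose (m + 1) (m + 2)"

definition rot' :: "nat \<Rightarrow> nat" where
  "rot' = transpose (m + 1) (m + 2) \<circ> transpose m (m + 1)"

lemma rot_simps:
  "rot m = m + 1" "rot (m + 1) = m + 2" "rot (m + 2) = m"
  "x \<noteq> m \<Longrightarrow> x \<noteq> m + 1 \<Longrightarrow> x \<noteq> m + 2 \<Longrightarrow> rot x = x"
  "rot' (m + 1) = m" "rot' (m + 2) = m + 1" "rot' m = m + 2"
  "x \<noteq> m \<Longrightarrow> x \<noteq> m + 1 \<Longrightarrow> x \<noteq> m + 2 \<Longrightarrow> rot' x = x"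
  unfolding rot_def rot'_def by (auto simp: transpose_def)

lemma rot_rot': "rot (rot' x) = x" "rot' (rot x) = x"
  unfolding rot_def rot'_def by simp_all

lemma rot_permutes: "rot permutes {1..m+2}" "rot' permutes {1..m+2}"
  unfolding rot_def rot'_def using m n by (intro permutes_compose permutes_swap_id; simp)+

lemma permutes_restrict:
  assumes "\<sigma> permutes {1..m+2}" "\<sigma> (m + 1) = m + 1" "\<sigma> (m + 2) = m + 2"
  shows "\<sigma> permutes {1..m}"
proof (rule permutes_superset[OF assms(1)])
  fix x assume "x \<in> {1..m+2} - {1..m}"
  then have "x = m + 1 \<or> x = m + 2" by auto
  then show "\<sigma> x = x" using assms by auto
qed

lemma permutes_extend: "\<tau> permutes {1..m} \<Longrightarrow> \<tau> permutes {1..m+2}"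
  by (erule permutes_subset) auto

text \<open>
  In a low permutation of \<open>[2n+2]\<close> without odd fixed points, \<open>2n+1\<close> is sent to \<open>2n+2\<close>. Each such
  permutation extends one of \<open>[2n]\<close> in one of three ways: by a separate 2-cycle, or by inserting \<open>2n+1, 2n+2\<close> into the cycle either just before \<open>2n\<close> or in place of
  \<open>2n\<close>, which then becomes a fixed point.
\<close>

lemma bij_cycle:
  "bij_betw (\<lambda>\<tau>. \<tau> \<circ> transpose (m + 1) (m + 2)) (low_semiderangements b n)
     {\<sigma> \<in> low_semiderangements b (n + 1). \<sigma> (m + 2) = m + 1}"
proof (rule bij_betw_byWitness[where f' = "\<lambda>\<sigma>. \<sigma> \<circ> transpose (m + 1) (m + 2)"])
  define t where "t = transpose (m + 1) (m + 2)"
  have t: "t (m + 1) = m + 2" "t (m + 2) = m + 1" "x \<noteq> m + 1 \<Longrightarrow> x \<noteq> m + 2 \<Longrightarrow> t x = x" for x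
    unfolding t_def by auto
  have tp: "t permutes {1..m+2}" unfolding t_def by (intro permutes_swap_id) auto
  show "(\<lambda>\<tau>. \<tau> \<circ> transpose (m + 1) (m + 2)) ` low_semiderangements b n
    \<subseteq> {\<sigma> \<in> low_semiderangements b (n + 1). \<sigma> (m + 2) = m + 1}"
    unfolding t_def[symmetric]
  proof (rule image_subsetI)
    fix \<tau> assume "\<tau> \<in> low_semiderangements b n"
    note \<tau> = low_last[OF this]
    define \<sigma> where "\<sigma> = \<tau> \<circ> t"
    have \<sigma>: "\<sigma> (m + 1) = m + 2" "\<sigma> (m + 2) = m + 1" "x \<noteq> m + 1 \<Longrightarrow> x \<noteq> m + 2 \<Longrightarrow> \<sigma> x = \<tau> x" for x
      unfolding \<sigma>_def using t \<tau>(3) by auto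
    have "low \<sigma>" unfolding low_def
    proof (intro allI impI)
      fix i j assume ij: "i < j" "\<sigma> i < i"
      consider "i = m + 1" | "i = m + 2" | "j = m + 1" | "j = m + 2"
        | "i \<noteq> m + 1" "i \<noteq> m + 2" "j \<noteq> m + 1" "j \<noteq> m + 2" by blast
      then show "i \<le> \<sigma> j"
        using ij \<sigma> \<tau>(2) \<tau>(3)[of j] by cases (auto simp: low_def)
    qed
    moreover have "\<sigma> permutes {1..m+2}"
      unfolding \<sigma>_def by (rule permutes_compose[OF tp permutes_extend[OF \<tau>(1)]])
    moreover have "if odd i then i < \<sigma> i else \<sigma> i \<le> i \<and> (b \<or> \<sigma> i \<noteq> i)"
      if i: "i \<in> {1..m+2}" for i
    proof -
      consider "i = m + 1" | "i = m + 2" | "i \<in> {1..m}" using i by fastforce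
      then show ?thesis using \<tau>(8)[of i] \<sigma> m by cases auto
    qed
    ultimately have "\<sigma> \<in> low_semiderangements b (n + 1)" by (rule mem_low_nextI)
    then show "\<tau> \<circ> t \<in> {\<sigma> \<in> low_semiderangements b (n + 1). \<sigma> (m + 2) = m + 1}"
      using \<sigma> unfolding \<sigma>_def by simp
  qed
  show "(\<lambda>\<sigma>. \<sigma> \<circ> transpose (m + 1) (m + 2))
      ` {\<sigma> \<in> low_semiderangements b (n + 1). \<sigma> (m + 2) = m + 1} \<subseteq> low_semiderangements b n"
    unfolding t_def[symmetric]
  proof (rule image_subsetI)
    fix \<sigma> assume s: "\<sigma> \<in> {\<sigma> \<in> low_semiderangements b (n + 1). \<sigma> (m + 2) = m + 1}"
    then have "\<sigma> \<in> low_semiderangements b (n + 1)" by simp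
    note \<sigma> = low_next_last[OF this]
    define \<tau> where "\<tau> = \<sigma> \<circ> t"
    have \<tau>: "\<tau> (m + 1) = m + 1" "\<tau> (m + 2) = m + 2" "x \<noteq> m + 1 \<Longrightarrow> x \<noteq> m + 2 \<Longrightarrow> \<tau> x = \<sigma> x" for x
      unfolding \<tau>_def using t \<sigma>(4) s by auto
    have "low \<tau>" unfolding low_def
    proof (intro allI impI)
      fix i j assume ij: "i < j" "\<tau> i < i"
      consider "i = m + 1" | "i = m + 2" | "j = m + 1" | "j = m + 2"
        | "i \<noteq> m + 1" "i \<noteq> m + 2" "j \<noteq> m + 1" "j \<noteq> m + 2" by blast
      then show "i \<le> \<tau> j"
        using ij \<tau> \<sigma>(2) by cases (auto simp: low_def)
    qed
    moreover have "\<tau> permutes {1..m}"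
      by (rule permutes_restrict) (use \<tau> permutes_compose[OF tp \<sigma>(1)] in \<open>auto simp: \<tau>_def\<close>)
    moreover have "if odd i then i < \<tau> i else \<tau> i \<le> i \<and> (b \<or> \<tau> i \<noteq> i)"
      if i: "i \<in> {1..m}" for i
      using i \<sigma>(10)[of i] \<tau>(3)[of i] by auto
    ultimately show "\<sigma> \<circ> t \<in> low_semiderangements b n"
      unfolding \<tau>_def by (rule mem_lowI)
  qed
qed (simp_all add: comp_assoc)

text \<open>This is the insertion just before \<open>m\<close>: the arc from \<open>m - 1\<close> to
  \<open>m\<close> becomes the path \<open>m - 1\<close>, \<open>m + 1\<close>,
  \<open>m + 2\<close>, \<open>m\<close>, and all other arcs stay.\<close>

lemma bij_fall:
  "bij_betw (\<lambda>\<tau>. rot \<circ> \<tau>) (low_semiderangements b n)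
     {\<sigma> \<in> low_semiderangements b (n + 1). \<sigma> (m + 2) = m}"
proof (rule bij_betw_byWitness[where f' = "\<lambda>\<sigma>. rot' \<circ> \<sigma>"])
  show "(\<lambda>\<tau>. rot \<circ> \<tau>) ` low_semiderangements b n
    \<subseteq> {\<sigma> \<in> low_semiderangements b (n + 1). \<sigma> (m + 2) = m}"
  proof (rule image_subsetI)
    fix \<tau> assume "\<tau> \<in> low_semiderangements b n"
    note \<tau> = low_last[OF this]
    define \<sigma> where "\<sigma> = rot \<circ> \<tau>"
    have \<sigma>: "\<sigma> (m - 1) = m + 1" "\<sigma> (m + 1) = m + 2" "\<sigma> (m + 2) = m"
      unfolding \<sigma>_def using \<tau>(3,4) rot_simps by auto
    have same: "\<sigma> x = \<tau> x" if "x \<noteq> m - 1" "x \<noteq> m + 1" "x \<noteq> m + 2" for x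
    proof (cases "x \<le> m")
      case True
      then show ?thesis unfolding \<sigma>_def using \<tau>(7)[of x] \<tau>(6)[OF that(1)] by (simp add: rot_simps[simplified])
    next
      case False
      then show ?thesis unfolding \<sigma>_def using \<tau>(3)[of x] that by (simp add: rot_simps[simplified])
    qed
    have "low \<sigma>" unfolding low_def
    proof (intro allI impI)
      fix i j assume ij: "i < j" "\<sigma> i < i"
      then have i: "i \<noteq> m - 1" "i \<noteq> m + 1" using \<sigma> by auto
      show "i \<le> \<sigma> j"
      proof (cases "i \<le> m")
        case True
        then have "\<tau> i < i" using ij same[of i] i by simp
        then have "i \<le> \<tau> j" using \<tau>(2) ij unfolding low_def by blast
        note le = this
        \<comment> \<open>The three altered images are at least \<open>m\<close>, hence at least
          \<open>i\<close>; any other \<open>j\<close> inherits the bound from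
          \<open>\<tau>\<close>.\<close>
        consider "j = m - 1" | "j = m + 1" | "j = m + 2" | "j \<noteq> m - 1" "j \<noteq> m + 1" "j \<noteq> m + 2" by blast
        then show ?thesis
          using True le by cases (simp_all only: \<sigma> same not_False_eq_True)
      next
        case False
        then have "j > m + 2" using ij i by simp
        then show ?thesis using same[of j] \<tau>(3)[of j] ij by simp
      qed
    qed
    moreover have "\<sigma> permutes {1..m+2}"
      unfolding \<sigma>_def by (rule permutes_compose[OF permutes_extend[OF \<tau>(1)] rot_permutes(1)])
    moreover have "if odd i then i < \<sigma> i else \<sigma> i \<le> i \<and> (b \<or> \<sigma> i \<noteq> i)"
      if i: "i \<in> {1..m+2}" for i
    proof -
      consider "i = m + 1" | "i = m + 2" | "i = m - 1" | "i \<in> {1..m}" "i \<noteq> m - 1"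
        using i by fastforce
      then show ?thesis
      proof cases
        case 3
        then show ?thesis using \<sigma> m n by auto
      next
        case 4
        then show ?thesis using \<tau>(8)[of i] same[of i] by simp
      qed (use \<sigma> m in auto)
    qed
    ultimately have "\<sigma> \<in> low_semiderangements b (n + 1)" by (rule mem_low_nextI)
    then show "rot \<circ> \<tau> \<in> {\<sigma> \<in> low_semiderangements b (n + 1). \<sigma> (m + 2) = m}"
      using \<sigma> unfolding \<sigma>_def by simp
  qed
  show "(\<lambda>\<sigma>. rot' \<circ> \<sigma>) ` {\<sigma> \<in> low_semiderangements b (n + 1). \<sigma> (m + 2) = m}
    \<subseteq> low_semiderangements b n"
  proof (rule image_subsetI)
    fix \<sigma> assume s: "\<sigma> \<in> {\<sigma> \<in> low_semiderangements b (n + 1). \<sigma> (m + 2) = m}"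
    then have "\<sigma> \<in> low_semiderangements b (n + 1)" by simp
    note \<sigma> = low_next_last[OF this]
    have inj: "\<sigma> x = \<sigma> y \<Longrightarrow> x = y" for x y using permutes_inj[OF \<sigma>(1)] by (rule injD)
    have s2: "\<sigma> (m + 2) = m" using s by simp
    \<comment> \<open>The value \<open>m\<close> is taken by \<open>m + 2\<close>, so
      \<open>m + 1\<close> is the only image left for \<open>m - 1\<close>.\<close>
    have "\<sigma> (m - 1) \<noteq> m" using inj[of "m - 1" "m + 2"] s2 by auto
    then have s1: "\<sigma> (m - 1) = m + 1" using \<sigma>(6,7) by simp
    define \<tau> where "\<tau> = rot' \<circ> \<sigma>"
    have \<tau>: "\<tau> (m - 1) = m" "\<tau> (m + 1) = m + 1" "\<tau> (m + 2) = m + 2"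
      unfolding \<tau>_def using s1 s2 \<sigma>(4) rot_simps by auto
    have same: "\<tau> x = \<sigma> x" if "x \<noteq> m - 1" "x \<noteq> m + 1" "x \<noteq> m + 2" for x
    proof -
      have "\<sigma> x \<noteq> m" "\<sigma> x \<noteq> m + 1" "\<sigma> x \<noteq> m + 2"
        using inj[of x "m - 1"] inj[of x "m + 1"] inj[of x "m + 2"] s1 s2 \<sigma>(4) that by auto
      then show ?thesis unfolding \<tau>_def by (simp add: rot_simps[simplified])
    qed
    have "low \<tau>" unfolding low_def
    proof (intro allI impI)
      fix i j assume ij: "i < j" "\<tau> i < i"
      then have i: "i \<noteq> m - 1" "i \<noteq> m + 1" "i \<noteq> m + 2" using \<tau> by auto
      then have "\<sigma> i < i" using same ij by simp
      then have "i \<le> \<sigma> j" "i \<le> m" using \<sigma>(2) \<sigma>(3)[of i] ij i unfolding low_def by force+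
      note le = this
      consider "j = m - 1" | "j = m + 1" | "j = m + 2" | "j \<noteq> m - 1" "j \<noteq> m + 1" "j \<noteq> m + 2" by blast
      then show "i \<le> \<tau> j"
        using le by cases (simp_all only: \<tau> same not_False_eq_True)
    qed
    moreover have "\<tau> permutes {1..m}"
      by (rule permutes_restrict)
        (use \<tau> permutes_compose[OF \<sigma>(1) rot_permutes(2)] in \<open>auto simp: \<tau>_def\<close>)
    moreover have "if odd i then i < \<tau> i else \<tau> i \<le> i \<and> (b \<or> \<tau> i \<noteq> i)"
      if i: "i \<in> {1..m}" for i
      using i \<sigma>(10)[of i] same[of i] \<tau>(1) m n by (cases "i = m - 1") auto
    ultimately show "rot' \<circ> \<sigma> \<in> low_semiderangements b n"
      unfolding \<tau>_def by (rule mem_lowI)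
  qed
qed (simp_all add: fun_eq_iff rot_rot')

text \<open>If \<open>m\<close> fell strictly, its arc and the arc from \<open>m + 2\<close> would
  both be open just below \<open>m\<close>.\<close>

lemma fixed_of_last_less:
  assumes "\<sigma> \<in> low_semiderangements b (n + 1)" "\<sigma> (m + 2) < m"
  shows "\<sigma> m = m"
  using low_next_last(2,8)[OF assms(1)] assms(2) unfolding low_def
  by (metis le_neq_implies_less less_add_same_cancel1 not_le zero_less_numeral)

text \<open>Here \<open>m + 2\<close> takes over the image of \<open>m\<close>, and the arc that
  ended in \<open>m\<close> now ends in \<open>m + 1\<close>. The flag is \<open>True\<close>
  because \<open>m\<close> becomes an even fixed point.\<close>

lemma bij_fixed:
  "bij_betw (\<lambda>\<tau>. rot \<circ> \<tau> \<circ> transpose m (m + 2)) (low_semiderangements True n)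
     {\<sigma> \<in> low_semiderangements True (n + 1). \<sigma> (m + 2) < m}"
proof (rule bij_betw_byWitness[where f' = "\<lambda>\<sigma>. rot' \<circ> \<sigma> \<circ> transpose m (m + 2)"])
  have m1: "m - 1 \<noteq> m" "m - 1 \<noteq> m + 1" "m - 1 \<noteq> m + 2" using m n by auto
  define t where "t = transpose m (m + 2)"
  have t: "t m = m + 2" "t (m + 2) = m" "x \<noteq> m \<Longrightarrow> x \<noteq> m + 2 \<Longrightarrow> t x = x" for x
    unfolding t_def by auto
  have tp: "t permutes {1..m+2}" unfolding t_def using m n by (intro permutes_swap_id) auto
  show "(\<lambda>\<tau>. rot \<circ> \<tau> \<circ> transpose m (m + 2)) ` low_semiderangements True n
    \<subseteq> {\<sigma> \<in> low_semiderangements True (n + 1). \<sigma> (m + 2) < m}"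
    unfolding t_def[symmetric]
  proof (rule image_subsetI)
    fix \<tau> assume "\<tau> \<in> low_semiderangements True n"
    note \<tau> = low_last[OF this]
    define \<sigma> where "\<sigma> = rot \<circ> \<tau> \<circ> t"
    have \<sigma>: "\<sigma> (m - 1) = m + 1" "\<sigma> m = m" "\<sigma> (m + 1) = m + 2" "\<sigma> (m + 2) = \<tau> m"
      unfolding \<sigma>_def using \<tau>(3,4,5) m1 by (simp_all add: rot_simps[simplified] t[simplified])
    have same: "\<sigma> x = \<tau> x" if "x \<noteq> m - 1" "x \<noteq> m" "x \<noteq> m + 1" "x \<noteq> m + 2" for x
    proof (cases "x \<le> m")
      case True
      then show ?thesis
        unfolding \<sigma>_def using \<tau>(7)[of x] \<tau>(6)[OF that(1)] that by (simp add: rot_simps[simplified] t[simplified])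
    next
      case False
      then show ?thesis unfolding \<sigma>_def using \<tau>(3)[of x] that by (simp add: rot_simps[simplified] t[simplified])
    qed
    have "low \<sigma>" unfolding low_def
    proof (intro allI impI)
      fix i j assume ij: "i < j" "\<sigma> i < i"
      then have i: "i \<noteq> m - 1" "i \<noteq> m" "i \<noteq> m + 1" using \<sigma> by auto
      show "i \<le> \<sigma> j"
      proof (cases "i \<le> m")
        case True
        then have "\<tau> i < i" "i < m" using ij same[of i] i by simp_all
        \<comment> \<open>The second bound is for \<open>j = m + 2\<close>, whose image under
          \<open>\<sigma>\<close> is \<open>\<tau> m\<close>.\<close>
        then have "i \<le> \<tau> j" "i \<le> \<tau> m" using \<tau>(2) ij unfolding low_def by blast+
        note le = this
        consider "j = m - 1" | "j = m" | "j = m + 1" | "j = m + 2"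
          | "j \<noteq> m - 1" "j \<noteq> m" "j \<noteq> m + 1" "j \<noteq> m + 2" by blast
        then show ?thesis
          using True le by cases (simp_all only: \<sigma> same not_False_eq_True)
      next
        case False
        then have "j > m + 2" using ij i by simp
        then show ?thesis using same[of j] \<tau>(3)[of j] ij by simp
      qed
    qed
    moreover have "\<sigma> permutes {1..m+2}"
      unfolding \<sigma>_def
      by (rule permutes_compose[OF tp permutes_compose[OF permutes_extend[OF \<tau>(1)] rot_permutes(1)]])
    moreover have "if odd i then i < \<sigma> i else \<sigma> i \<le> i \<and> (True \<or> \<sigma> i \<noteq> i)"
      if i: "i \<in> {1..m+2}" for i
    proof -
      consider "i = m + 1" | "i = m + 2" | "i = m - 1" | "i = m" | "i \<in> {1..m}" "i \<noteq> m - 1" "i \<noteq> m"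
        using i by fastforce
      then show ?thesis
      proof cases
        case 3
        then show ?thesis using \<sigma> m n by auto
      next
        case 5
        then show ?thesis using \<tau>(8)[of i] same[of i] by simp
      qed (use \<sigma> m \<tau>(5) in auto)
    qed
    ultimately have "\<sigma> \<in> low_semiderangements True (n + 1)" by (rule mem_low_nextI)
    then show "rot \<circ> \<tau> \<circ> t \<in> {\<sigma> \<in> low_semiderangements True (n + 1). \<sigma> (m + 2) < m}"
      using \<sigma> \<tau>(5) unfolding \<sigma>_def by simp
  qed
  show "(\<lambda>\<sigma>. rot' \<circ> \<sigma> \<circ> transpose m (m + 2))
      ` {\<sigma> \<in> low_semiderangements True (n + 1). \<sigma> (m + 2) < m} \<subseteq> low_semiderangements True n"
    unfolding t_def[symmetric]
  proof (rule image_subsetI)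
    fix \<sigma> assume s: "\<sigma> \<in> {\<sigma> \<in> low_semiderangements True (n + 1). \<sigma> (m + 2) < m}"
    then have s': "\<sigma> \<in> low_semiderangements True (n + 1)" "\<sigma> (m + 2) < m" by simp_all
    note \<sigma> = low_next_last[OF s'(1)]
    have inj: "\<sigma> x = \<sigma> y \<Longrightarrow> x = y" for x y using permutes_inj[OF \<sigma>(1)] by (rule injD)
    have s0: "\<sigma> m = m" by (rule fixed_of_last_less[OF s'])
    have "\<sigma> (m - 1) \<noteq> m" using inj[of "m - 1" m] s0 m1 by auto
    then have s1: "\<sigma> (m - 1) = m + 1" using \<sigma>(6,7) by simp
    define \<tau> where "\<tau> = rot' \<circ> \<sigma> \<circ> t"
    have \<tau>: "\<tau> (m - 1) = m" "\<tau> m = \<sigma> (m + 2)" "\<tau> (m + 1) = m + 1" "\<tau> (m + 2) = m + 2"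
      unfolding \<tau>_def using s1 s0 s'(2) \<sigma>(4) m1 by (simp_all add: rot_simps[simplified] t[simplified])
    have same: "\<tau> x = \<sigma> x" if "x \<noteq> m - 1" "x \<noteq> m" "x \<noteq> m + 1" "x \<noteq> m + 2" for x
    proof -
      have "\<sigma> x \<noteq> m" "\<sigma> x \<noteq> m + 1" "\<sigma> x \<noteq> m + 2"
        using inj[of x "m - 1"] inj[of x "m + 1"] inj[of x m] s1 s0 \<sigma>(4) that by auto
      then show ?thesis unfolding \<tau>_def using that by (simp add: rot_simps[simplified] t[simplified])
    qed
    have "low \<tau>" unfolding low_def
    proof (intro allI impI)
      fix i j assume ij: "i < j" "\<tau> i < i"
      then have i: "i \<noteq> m - 1" "i \<noteq> m + 1" "i \<noteq> m + 2" using \<tau> by auto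
      have out: "\<tau> x = x" if "x > m" for x
        using that \<tau> same[of x] \<sigma>(3)[of x] by (cases "x = m + 1"; cases "x = m + 2") auto
      then have "i \<le> m" using ij by (metis less_irrefl not_le)
      show "i \<le> \<tau> j"
      proof (cases "i = m")
        case True
        then show ?thesis using out[of j] ij by simp
      next
        case False
        then have "\<sigma> i < i" "i < m + 2" using same i ij \<open>i \<le> m\<close> by simp_all
        \<comment> \<open>Conversely, the second bound is for \<open>j = m\<close>, whose image
          under \<open>\<tau>\<close> is \<open>\<sigma> (m + 2)\<close>.\<close>
        then have "i \<le> \<sigma> j" "i \<le> \<sigma> (m + 2)" using \<sigma>(2) ij unfolding low_def by blast+
        note le = this
        consider "j = m - 1" | "j = m" | "j = m + 1" | "j = m + 2"
          | "j \<noteq> m - 1" "j \<noteq> m" "j \<noteq> m + 1" "j \<noteq> m + 2" by blast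
        then show ?thesis
          using \<open>i \<le> m\<close> le by cases (simp_all only: \<tau> same not_False_eq_True)
      qed
    qed
    moreover have "\<tau> permutes {1..m}"
      by (rule permutes_restrict)
        (use \<tau> permutes_compose[OF tp permutes_compose[OF \<sigma>(1) rot_permutes(2)]] in
          \<open>auto simp: \<tau>_def\<close>)
    moreover have "if odd i then i < \<tau> i else \<tau> i \<le> i \<and> (True \<or> \<tau> i \<noteq> i)"
      if i: "i \<in> {1..m}" for i
      using i \<sigma>(10)[of i] same[of i] \<tau>(1,2) s'(2) m n by (cases "i = m - 1"; cases "i = m") auto
    ultimately show "rot' \<circ> \<sigma> \<circ> t \<in> low_semiderangements True n"
      unfolding \<tau>_def by (rule mem_lowI)
  qed
qed (simp_all add: fun_eq_iff rot_rot')

lemma finite_low_semiderangements: "finite (low_semiderangements b k)"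
  by (rule finite_subset[OF _ finite_permutations[of "{1..2*k}"]])
    (auto simp: low_semiderangements_def)

text \<open>The image of \<open>m + 2\<close> is \<open>m + 1\<close>, \<open>m\<close> or smaller,
  and each class is counted by one of the bijections. The last class forces the even point
  \<open>m\<close> to be fixed, so it is empty when \<open>b\<close> is false.\<close>

lemma card_low_semiderangements_step:
  "card (low_semiderangements b (n + 1)) = (if b then 3 else 2) * card (low_semiderangements b n)"
proof -
  let ?L = "low_semiderangements b (n + 1)"
  let ?A = "{\<sigma> \<in> ?L. \<sigma> (m + 2) = m + 1}" and ?B = "{\<sigma> \<in> ?L. \<sigma> (m + 2) = m}"
    and ?C = "{\<sigma> \<in> ?L. \<sigma> (m + 2) < m}"
  have L: "?L = ?A \<union> ?B \<union> ?C"
  proof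
    show "?L \<subseteq> ?A \<union> ?B \<union> ?C" using low_next_last(5) by fastforce
  qed auto
  have fin: "finite ?A" "finite ?B" "finite ?C" using finite_low_semiderangements by simp_all
  have "card (?A \<union> ?B \<union> ?C) = card ?A + card ?B + card ?C"
    using fin by (subst card_Un_disjoint; (subst card_Un_disjoint)?) auto
  moreover have "card ?A = card (low_semiderangements b n)"
    using bij_betw_same_card[OF bij_cycle] by metis
  moreover have "card ?B = card (low_semiderangements b n)"
    using bij_betw_same_card[OF bij_fall] by metis
  moreover have "card ?C = (if b then card (low_semiderangements b n) else 0)"
  proof (cases b)
    case True
    then show ?thesis using bij_betw_same_card[OF bij_fixed] by simp
  next
    case False
    have e: "?C = {}"
    proof -
      have False if "\<sigma> \<in> ?C" for \<sigma>
      proof -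
        have s: "\<sigma> \<in> ?L" "\<sigma> (m + 2) < m" using that by simp_all
        have "if odd m then m < \<sigma> m else \<sigma> m \<le> m \<and> (b \<or> \<sigma> m \<noteq> m)"
          by (rule low_next_last(10)[OF s(1)]) (use m n in auto)
        then show False using fixed_of_last_less[OF s] False m by simp
      qed
      then show ?thesis by blast
    qed
    show ?thesis unfolding e using False by simp
  qed
  ultimately show ?thesis using L by auto
qed

end

section \<open>Initial values and the closed form of the count\<close>

lemma card_low_semiderangements_0: "card (low_semiderangements b 0) = 1"
proof -
  have "low_semiderangements b 0 = {id}"
    unfolding low_semiderangements_def by (auto simp: low_def)
  then show ?thesis by simp
qed

text \<open>From \<open>n = 0\<close> to \<open>n = 1\<close> only the separate 2-cycle is
  available, as there is no earlier cycle to insert into. Multiplication therefore starts at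
  \<open>n = 1\<close>, whence the exponent \<open>n - 1\<close>.\<close>

lemma card_low_semiderangements_1: "card (low_semiderangements b 1) = 1"
proof -
  have "low_semiderangements b 1 = {transpose 1 2}"
  proof
    show "low_semiderangements b 1 \<subseteq> {transpose 1 2}"
    proof
      fix \<sigma> assume "\<sigma> \<in> low_semiderangements b 1"
      note \<sigma> = low_last[OF refl order_refl this, simplified]
      have "\<sigma> 2 \<in> {1..2}" using permutes_in_image[OF \<sigma>(1), of 2] by simp
      then have "\<sigma> 2 = 1" using \<sigma>(5) by simp
      have "\<sigma> x = transpose 1 2 x" for x
        using \<sigma>(4) \<open>\<sigma> 2 = 1\<close> permutes_not_in[OF \<sigma>(1), of x]
        by (cases "x = 1"; cases "x = 2") auto
      then show "\<sigma> \<in> {transpose 1 2}" by auto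
    qed
    have *: "{1..2*1} = {1, 2 :: nat}" by auto
    show "{transpose 1 2} \<subseteq> low_semiderangements b 1"
      unfolding low_semiderangements_def *
      by (auto simp: low_def transpose_def intro!: permutes_swap_id)
  qed
  then show ?thesis by simp
qed

lemma card_low_semiderangements:
  "card (low_semiderangements b n) = (if n = 0 then 1 else (if b then 3 else 2) ^ (n - 1))"
proof (induction n)
  case 0
  then show ?case by (simp add: card_low_semiderangements_0)
next
  case (Suc n)
  show ?case
  proof (cases "n = 0")
    case True
    then show ?thesis using card_low_semiderangements_1 by simp
  next
    case False
    then obtain k where "n = Suc k" using not0_implies_Suc by blast
    then show ?thesis using Suc card_low_semiderangements_step[OF refl, of n b] by simp
  qed
qed

subsection \<open>Signed sums and cyclic sieving\<close>

lemma finite_D_permutations: "finite (D_permutations n)"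
  by (rule finite_subset[OF _ finite_permutations[of "{1..2*n}"]])
    (auto simp: D_permutations_def)

text \<open>Rises, falls and fixed points survive the swap, so each of the three families is closed
  under it.\<close>

lemma swap_pivot_D_permutations:
  assumes "\<sigma> \<in> D_permutations n" "\<not> low \<sigma>"
  shows "swap_pivot \<sigma> \<in> D_permutations n" "swap_pivot \<sigma> x = x \<longleftrightarrow> \<sigma> x = x"
proof -
  interpret high_permutation "2*n" \<sigma>
    using assms mem_D_permutations by unfold_locales auto
  have "i \<le> \<tau> i \<longleftrightarrow> i \<le> \<sigma> i" "\<tau> i \<le> i \<longleftrightarrow> \<sigma> i \<le> i" for i
    using swap_type[of i] by linarith+
  then show "\<tau> \<in> D_permutations n"
    using assms(1) swap_permutes unfolding mem_D_permutations by simp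
  show "\<tau> x = x \<longleftrightarrow> \<sigma> x = x" by (rule swap_fix)
qed

lemma sign_sums_lower_stat:
  assumes "lower_stat (2*n) s"
  shows "(\<Sum>\<sigma>\<in>D_e_semiderangements n. (-1) ^ s \<sigma>) = int (if n = 0 then 1 else 3 ^ (n - 1))"
    "(\<Sum>\<sigma>\<in>D_o_semiderangements n. (-1) ^ s \<sigma>) = int (if n = 0 then 1 else 3 ^ (n - 1))"
    "(\<Sum>\<sigma>\<in>D_derangements n. (-1) ^ s \<sigma>) = int (if n = 0 then 1 else 2 ^ (n - 1))"
proof -
  \<comment> \<open>The families differ only in which fixed points are forbidden; the predicate
    \<open>P\<close> covers all three cases.\<close>
  have sum: "(\<Sum>\<sigma>\<in>X. (-1) ^ s \<sigma>) = int (card {\<sigma>\<in>X. low \<sigma>})"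
    if "X = {\<sigma> \<in> D_permutations n. \<forall>i\<in>{1..2*n}. P i \<longrightarrow> \<sigma> i \<noteq> i}" for X P
  proof (rule sign_sum_lower_stat[OF assms])
    show "finite X" using finite_D_permutations that by simp
    show "\<sigma> permutes {1..2*n}" if "\<sigma> \<in> X" for \<sigma>
      using that \<open>X = _\<close> mem_D_permutations by simp
    show "swap_pivot \<sigma> \<in> X" if "\<sigma> \<in> X" "\<not> low \<sigma>" for \<sigma>
      using that \<open>X = _\<close> swap_pivot_D_permutations[of \<sigma> n] by simp
  qed
  have o: "card {\<sigma> \<in> D_o_semiderangements n. low \<sigma>} = (if n = 0 then 1 else 3 ^ (n - 1))"
    unfolding low_D_o_semiderangements card_low_semiderangements by simp
  then show "(\<Sum>\<sigma>\<in>D_o_semiderangements n. (-1) ^ s \<sigma>) = int (if n = 0 then 1 else 3 ^ (n - 1))"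
    using sum[OF D_o_semiderangements_def] by simp
  have perm: "\<sigma> permutes {1..2*n}"
    if "\<sigma> \<in> D_o_semiderangements n \<union> D_e_semiderangements n" for \<sigma>
    using that mem_D_permutations
    unfolding D_o_semiderangements_def D_e_semiderangements_def by auto
  have "bij_betw (flip_conj (2*n)) {\<sigma> \<in> D_e_semiderangements n. low \<sigma>}
      {\<sigma> \<in> D_o_semiderangements n. low \<sigma>}"
    by (rule bij_betw_byWitness[where f' = "flip_conj (2*n)"])
      (use flip_conj_semiderangements low_flip_conj perm in auto)
  from bij_betw_same_card[OF this]
  have "card {\<sigma> \<in> D_e_semiderangements n. low \<sigma>} = (if n = 0 then 1 else 3 ^ (n - 1))"
    unfolding o .
  then show "(\<Sum>\<sigma>\<in>D_e_semiderangements n. (-1) ^ s \<sigma>) = int (if n = 0 then 1 else 3 ^ (n - 1))"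
    using sum[OF D_e_semiderangements_def] by simp
  have "card {\<sigma> \<in> D_derangements n. low \<sigma>} = (if n = 0 then 1 else 2 ^ (n - 1))"
    unfolding low_D_derangements card_low_semiderangements by simp
  then show "(\<Sum>\<sigma>\<in>D_derangements n. (-1) ^ s \<sigma>) = int (if n = 0 then 1 else 2 ^ (n - 1))"
    using sum[of "D_derangements n" "\<lambda>_. True"] by (simp add: D_derangements_def)
qed

text \<open>Reversal carries the signed sum of \<open>u\<close> to that of \<open>s\<close>. It
  exchanges e- and o-semiderangements, whose counts agree, and preserves derangements.\<close>

lemma sign_sums_upper_stat:
  assumes u: "\<And>\<sigma>. \<sigma> permutes {1..2*n} \<Longrightarrow> u \<sigma> = s (flip_conj (2*n) \<sigma>)"
    and s: "lower_stat (2*n) s"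
  shows "(\<Sum>\<sigma>\<in>D_e_semiderangements n. (-1) ^ u \<sigma>) = int (if n = 0 then 1 else 3 ^ (n - 1))"
    "(\<Sum>\<sigma>\<in>D_o_semiderangements n. (-1) ^ u \<sigma>) = int (if n = 0 then 1 else 3 ^ (n - 1))"
    "(\<Sum>\<sigma>\<in>D_derangements n. (-1) ^ u \<sigma>) = int (if n = 0 then 1 else 2 ^ (n - 1))"
proof -
  have re: "(\<Sum>\<sigma>\<in>X. (-1) ^ u \<sigma>) = (\<Sum>\<sigma>\<in>Y. (-1 :: int) ^ s \<sigma>)"
    if "X \<subseteq> D_permutations n" "\<And>\<sigma>. \<sigma> \<in> X \<Longrightarrow> flip_conj (2*n) \<sigma> \<in> Y"
      "\<And>\<sigma>. \<sigma> \<in> Y \<Longrightarrow> flip_conj (2*n) \<sigma> \<in> X" for X Y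
    by (rule sum.reindex_bij_witness[of _ "flip_conj (2*n)" "flip_conj (2*n)"])
      (use that u mem_D_permutations in auto)
  have sub: "D_e_semiderangements n \<subseteq> D_permutations n" "D_o_semiderangements n \<subseteq> D_permutations n"
    "D_derangements n \<subseteq> D_permutations n"
    unfolding D_e_semiderangements_def D_o_semiderangements_def D_derangements_def by auto
  show "(\<Sum>\<sigma>\<in>D_e_semiderangements n. (-1) ^ u \<sigma>) = int (if n = 0 then 1 else 3 ^ (n - 1))"
    by (rule trans[OF re[OF sub(1)] sign_sums_lower_stat(2)[OF s]])
      (erule flip_conj_semiderangements)+
  show "(\<Sum>\<sigma>\<in>D_o_semiderangements n. (-1) ^ u \<sigma>) = int (if n = 0 then 1 else 3 ^ (n - 1))"
    by (rule trans[OF re[OF sub(2)] sign_sums_lower_stat(1)[OF s]])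
      (erule flip_conj_semiderangements)+
  show "(\<Sum>\<sigma>\<in>D_derangements n. (-1) ^ u \<sigma>) = int (if n = 0 then 1 else 2 ^ (n - 1))"
    by (rule trans[OF re[OF sub(3)] sign_sums_lower_stat(3)[OF s]])
      (erule flip_conj_semiderangements)+
qed

text \<open>At 1 every monomial is 1, which gives the cardinality; at -1 the polynomial is the
  signed sum, equal by assumption to the prescribed number of fixed points.\<close>

lemma stat_exhibits_CSP_I:
  assumes "\<And>n. (\<Sum>x\<in>X n. (-1) ^ stat n x) = int (a n)"
  shows "stat_exhibits_CSP stat X a"
  unfolding stat_exhibits_CSP_def exhibits_CSP_def stat_poly_def
  using assms by (auto simp: poly_sum poly_monom)

theorem theorem6p8:
  fixes stat :: "nat \<Rightarrow> (nat \<Rightarrow> nat) \<Rightarrow> nat"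
  assumes "stat \<in>
    {nrcpeak,
     nrcval,
     (\<lambda>N \<sigma>. nrcpeak N \<sigma> + nrcval N \<sigma> + nrcdrise N \<sigma> + nrcdfall N \<sigma>),
     lcrosscpeak,
     lnestcpeak,
     ucrosscval,
     unestcval,
     lcross,
     lnest,
     ucross,
     unest,
     (\<lambda>N \<sigma>. ucross N \<sigma> + lcross N \<sigma>),
     (\<lambda>N \<sigma>. unest N \<sigma> + lnest N \<sigma>)}"
  shows "stat_exhibits_CSP (\<lambda>n. stat (2*n)) D_e_semiderangements
           (\<lambda>n. if n = 0 then 1 else 3 ^ (n - 1))
       \<and> stat_exhibits_CSP (\<lambda>n. stat (2*n)) D_o_semiderangements
           (\<lambda>n. if n = 0 then 1 else 3 ^ (n - 1))
       \<and> stat_exhibits_CSP (\<lambda>n. stat (2*n)) D_derangements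
           (\<lambda>n. if n = 0 then 1 else 2 ^ (n - 1))"
proof -
  \<comment> \<open>The second alternative is for \<open>nrcval\<close>, \<open>ucrosscval\<close>,
    \<open>unestcval\<close>, \<open>ucross\<close> and \<open>unest\<close>, which reversal turns
    into lower statistics.\<close>
  have "lower_stat (2*n) (stat (2*n)) \<or>
    (\<exists>s. lower_stat (2*n) s \<and>
      (\<forall>\<sigma>. \<sigma> permutes {1..2*n} \<longrightarrow> stat (2*n) \<sigma> = s (flip_conj (2*n) \<sigma>)))" for n
    using assms
    by (elim insertE emptyE; hypsubst) (use lower_stats upper_stats_flip in blast)+
  then show ?thesis
    by (intro conjI stat_exhibits_CSP_I) (metis sign_sums_lower_stat sign_sums_upper_stat)+
qed

end
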